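(* Let $\mathbb{K}\in\{\mathbb{R},\mathbb{C}\}$, let $\mathfrak{g}=\mathfrak{g}(A)(\mathbb{K})$ be a split untwisted affine Kac--Moody algebra over $\mathbb{K}$, let $\mathfrak{k}$ be its subalgebra fixed by the Cartan--Chevalley involution, and let $\mathring{\mathfrak{g}}=\mathring{\mathfrak{k}}\oplus\mathring{\mathfrak{p}}$ be the Cartan decomposition of the distinguished classical subalgebra $\mathring{\mathfrak{g}}$ of $\mathfrak{g}$. Let $\mathbb{P}=\mathbb{K}[[u]]$, let $\mathbb{P}^{+}$ (resp. $\mathbb{P}^{-}$) be the $\mathbb{K}$-submodule of even (resp. odd) formal power series in $u$, and set $$\mathfrak{N}(\mathbb{P})=(\mathbb{P}^{+}\otimes\mathring{\mathfrak{k}})\oplus(\mathbb{P}^{-}\otimes\mathring{\mathfrak{p}}),\qquad [P\otimes x,Q\otimes y]=(PQ)\otimes[x,y].$$ Then for each choice of sign the linear map $\rho_{\pm}:\mathfrak{k}\to\mathfrak{N}(\mathbb{P})$ given by $$(t^{n}+t^{-n})\otimes x\mapsto(\pm1)^{n}\sum_{k=0}^{\infty}a_{2k}^{(n)}u^{2k}\otimes x\quad(x\in\mathring{\mathfrak{k}},\ n\ge 0),$$ $$(t^{n}-t^{-n})\otimes y\mapsto(\pm1)^{n}\sum_{k=0}^{\infty}a_{2k+1}^{(n)}u^{2k+1}\otimes y\quad(y\in\mathring{\mathfrak{p}},\ n\ge 0)$$ is a nonsurjective monomorphism of Lie algebras. Moreover, for $N\in\mathbb{N}$ set $\mathbb{P}_N=\mathbb{P}/\mathcal{I}_N$,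 where $\mathcal{I}_N=(u^{N+1})$ is the ideal generated by $u^{N+1}$. The projection $\mathbb{P}\to\mathbb{P}_N$ induces a homomorphism of Lie algebras $\pi_N:\mathfrak{N}(\mathbb{P})\to\mathfrak{N}(\mathbb{P}_N)$ such that $\rho_{\pm}^{(N)}:=\pi_N\circ\rho_{\pm}:\mathfrak{k}\to\mathfrak{N}(\mathbb{P}_N)$ is an epimorphism (i.e. surjective).
   Context: $\mathbb{N}=\{0,1,2,\dots\}$. $A$ is an indecomposable generalised Cartan matrix of untwisted affine type; $\mathring{\mathfrak{g}}$ is the split finite-dimensional simple Lie algebra over $\mathbb{K}$ obtained by deleting the affine node of the Dynkin diagram of $A$. The (linear) Cartan--Chevalley involution sends $e_i\mapsto -f_i$, $f_i\mapsto -e_i$, $h\mapsto -h$; its analogue $\mathring\omega$ on $\mathring{\mathfrak{g}}$ has $+1$ eigenspace $\mathring{\mathfrak{k}}$ and $-1$ eigenspace $\mathring{\mathfrak{p}}$. With $\mathfrak{L}=\mathbb{K}[t,t^{-1}]$ and $\mathfrak{L}^{\pm}$ the $\pm1$ eigenspaces of $t\mapsto t^{-1}$ on $\mathfrak{L}$ (spanned by $t^n\pm t^{-n}$, $n\ge 0$), the algebra $\mathfrak{k}$ is realised inside the loop algebra $\mathfrak{L}\otimes\mathring{\mathfrak{g}}$ as $$\mathfrak{k}=(\mathfrak{L}^{+}\otimes\mathring{\mathfrak{k}})\oplus(\mathfrak{L}^{-}\otimes\mathring{\mathfrak{p}}),\qquad [P\otimes x,Q\otimes y]=(PQ)\otimes[x,y].$$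 The coefficients are $$a_{2k}^{(n)}=2\sum_{\ell=0}^{n}\binom{2n}{2\ell}\binom{k-\ell+n-1}{k-\ell},\qquad a_{2k+1}^{(n)}=-2\sum_{\ell=0}^{n-1}\binom{2n}{2\ell+1}\binom{k-\ell+n-1}{k-\ell},$$ with $\binom{m}{j}=0$ for $j<0$, $\binom{m}{0}=1$, and empty sums equal to $0$; equivalently, they are the Taylor coefficients in $t^n+t^{-n}=(\pm1)^n\sum_k a^{(n)}_{2k}u^{2k}$ and $t^n-t^{-n}=(\pm1)^n\sum_k a^{(n)}_{2k+1}u^{2k+1}$ for $t=\pm\frac{1-u}{1+u}$. $\mathfrak{N}(\mathbb{P}_N)=(\mathbb{P}_N^{+}\otimes\mathring{\mathfrak{k}})\oplus(\mathbb{P}_N^{-}\otimes\mathring{\mathfrak{p}})$ with bracket $[P\otimes x,Q\otimes y]=(PQ)\otimes[x,y]$, where $\mathbb{P}_N^{\pm}$ are the images of $\mathbb{P}^{\pm}$ in $\mathbb{P}_N$. *)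

theory Defs
  imports
    Complex_Main
    "HOL-Library.Poly_Mapping"
    "HOL-Library.Function_Algebras"
    "HOL-Library.Product_Plus"
    "HOL-Computational_Algebra.Formal_Power_Series"
begin

section \<open>The ground field\<close>

text \<open>The ground field is \<open>\<real>\<close> or \<open>\<complex>\<close>: up to an isomorphism of fields, these are the only
  types in the following class. A bijection that respects sums and products also respects 0 and 1.\<close>

class real_or_complex = field_char_0 +
  assumes real_or_complex:
    "(\<exists>\<phi> :: 'a \<Rightarrow> real. bij \<phi> \<and> (\<forall>x y. \<phi> (x + y) = \<phi> x + \<phi> y \<and> \<phi> (x * y) = \<phi> x * \<phi> y)) \<or>
     (\<exists>\<phi> :: 'a \<Rightarrow> complex. bij \<phi> \<and> (\<forall>x y. \<phi> (x + y) = \<phi> x + \<phi> y \<and> \<phi> (x * y) = \<phi> x * \<phi> y))"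

instance real :: real_or_complex
  by standard (rule disjI1, rule exI[of _ "\<lambda>x. x"], simp add: bij_def inj_on_def surj_def)

instance complex :: real_or_complex
  by standard (rule disjI2, rule exI[of _ "\<lambda>x. x"], simp add: bij_def inj_on_def surj_def)


section \<open>Lie algebras\<close>

record ('k, 'a) lie_struct =
  lcarrier :: "'a set"
  lzero :: "'a"
  ladd :: "'a \<Rightarrow> 'a \<Rightarrow> 'a"
  lscale :: "'k \<Rightarrow> 'a \<Rightarrow> 'a"
  lbracket :: "'a \<Rightarrow> 'a \<Rightarrow> 'a"

locale lie_algebra =
  fixes L :: "('k::field, 'a) lie_struct"
  assumes zero_closed: "lzero L \<in> lcarrier L"
    and add_closed: "\<lbrakk>x \<in> lcarrier L; y \<in> lcarrier L\<rbrakk> \<Longrightarrow> ladd L x y \<in> lcarrier L"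
    and scale_closed: "x \<in> lcarrier L \<Longrightarrow> lscale L c x \<in> lcarrier L"
    and bracket_closed: "\<lbrakk>x \<in> lcarrier L; y \<in> lcarrier L\<rbrakk> \<Longrightarrow> lbracket L x y \<in> lcarrier L"
    and add_assoc: "\<lbrakk>x \<in> lcarrier L; y \<in> lcarrier L; z \<in> lcarrier L\<rbrakk>
          \<Longrightarrow> ladd L (ladd L x y) z = ladd L x (ladd L y z)"
    and add_commute: "\<lbrakk>x \<in> lcarrier L; y \<in> lcarrier L\<rbrakk> \<Longrightarrow> ladd L x y = ladd L y x"
    and add_zero: "x \<in> lcarrier L \<Longrightarrow> ladd L (lzero L) x = x"
    and add_inverse: "x \<in> lcarrier L \<Longrightarrow> \<exists>y \<in> lcarrier L. ladd L x y = lzero L"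
    and scale_add: "\<lbrakk>x \<in> lcarrier L; y \<in> lcarrier L\<rbrakk>
          \<Longrightarrow> lscale L c (ladd L x y) = ladd L (lscale L c x) (lscale L c y)"
    and add_scale: "x \<in> lcarrier L \<Longrightarrow> lscale L (c + d) x = ladd L (lscale L c x) (lscale L d x)"
    and scale_scale: "x \<in> lcarrier L \<Longrightarrow> lscale L c (lscale L d x) = lscale L (c * d) x"
    and scale_one: "x \<in> lcarrier L \<Longrightarrow> lscale L 1 x = x"
    and bracket_add_left: "\<lbrakk>x \<in> lcarrier L; y \<in> lcarrier L; z \<in> lcarrier L\<rbrakk>
          \<Longrightarrow> lbracket L (ladd L x y) z = ladd L (lbracket L x z) (lbracket L y z)"
    and bracket_add_right: "\<lbrakk>x \<in> lcarrier L; y \<in> lcarrier L; z \<in> lcarrier L\<rbrakk>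
          \<Longrightarrow> lbracket L x (ladd L y z) = ladd L (lbracket L x y) (lbracket L x z)"
    and bracket_scale_left: "\<lbrakk>x \<in> lcarrier L; y \<in> lcarrier L\<rbrakk>
          \<Longrightarrow> lbracket L (lscale L c x) y = lscale L c (lbracket L x y)"
    and bracket_scale_right: "\<lbrakk>x \<in> lcarrier L; y \<in> lcarrier L\<rbrakk>
          \<Longrightarrow> lbracket L x (lscale L c y) = lscale L c (lbracket L x y)"
    and bracket_alternating: "x \<in> lcarrier L \<Longrightarrow> lbracket L x x = lzero L"
    and jacobi: "\<lbrakk>x \<in> lcarrier L; y \<in> lcarrier L; z \<in> lcarrier L\<rbrakk>
          \<Longrightarrow> ladd L (lbracket L x (lbracket L y z))
                (ladd L (lbracket L y (lbracket L z x)) (lbracket L z (lbracket L x y))) = lzero L"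

definition linear_between ::
    "('a \<Rightarrow> 'b) \<Rightarrow> ('k, 'a) lie_struct \<Rightarrow> ('k, 'b) lie_struct \<Rightarrow> bool" where
  "linear_between \<phi> L M \<longleftrightarrow>
     (\<forall>x \<in> lcarrier L. \<phi> x \<in> lcarrier M) \<and>
     (\<forall>x \<in> lcarrier L. \<forall>y \<in> lcarrier L. \<phi> (ladd L x y) = ladd M (\<phi> x) (\<phi> y)) \<and>
     (\<forall>c. \<forall>x \<in> lcarrier L. \<phi> (lscale L c x) = lscale M c (\<phi> x))"

definition lie_hom ::
    "('a \<Rightarrow> 'b) \<Rightarrow> ('k::field, 'a) lie_struct \<Rightarrow> ('k, 'b) lie_struct \<Rightarrow> bool" where
  "lie_hom \<phi> L M \<longleftrightarrow> lie_algebra L \<and> lie_algebra M \<and> linear_between \<phi> L M \<and>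
     (\<forall>x \<in> lcarrier L. \<forall>y \<in> lcarrier L. \<phi> (lbracket L x y) = lbracket M (\<phi> x) (\<phi> y))"

definition lie_mono ::
    "('a \<Rightarrow> 'b) \<Rightarrow> ('k::field, 'a) lie_struct \<Rightarrow> ('k, 'b) lie_struct \<Rightarrow> bool" where
  "lie_mono \<phi> L M \<longleftrightarrow> lie_hom \<phi> L M \<and> inj_on \<phi> (lcarrier L)"

definition lie_epi ::
    "('a \<Rightarrow> 'b) \<Rightarrow> ('k::field, 'a) lie_struct \<Rightarrow> ('k, 'b) lie_struct \<Rightarrow> bool" where
  "lie_epi \<phi> L M \<longleftrightarrow> lie_hom \<phi> L M \<and> \<phi> ` lcarrier L = lcarrier M"

text \<open>A Lie algebra whose underlying vector space is a whole type.\<close>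

definition lie_of ::
    "('k \<Rightarrow> 'a \<Rightarrow> 'a) \<Rightarrow> ('a \<Rightarrow> 'a \<Rightarrow> 'a) \<Rightarrow> ('k, 'a::ab_group_add) lie_struct" where
  "lie_of sc br = \<lparr>lcarrier = UNIV, lzero = 0, ladd = (+), lscale = sc, lbracket = br\<rparr>"

definition lie_restrict :: "('k, 'a) lie_struct \<Rightarrow> 'a set \<Rightarrow> ('k, 'a) lie_struct" where
  "lie_restrict L S = L\<lparr>lcarrier := S\<rparr>"

definition lie_coset :: "('k, 'a) lie_struct \<Rightarrow> 'a set \<Rightarrow> 'a \<Rightarrow> 'a set" where
  "lie_coset L J x = {ladd L x j | j. j \<in> J}"

text \<open>The quotient of \<open>L\<close> by an ideal \<open>J\<close>, with cosets as elements. In the scalar multiplication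
  and in the bracket, adding \<open>J\<close> to the set of all values makes the result a full coset.\<close>

definition lie_quotient :: "('k, 'a) lie_struct \<Rightarrow> 'a set \<Rightarrow> ('k, 'a set) lie_struct" where
  "lie_quotient L J =
     \<lparr>lcarrier = lie_coset L J ` lcarrier L,
      lzero = J,
      ladd = (\<lambda>X Y. {ladd L x y | x y. x \<in> X \<and> y \<in> Y}),
      lscale = (\<lambda>c X. {ladd L (lscale L c x) j | x j. x \<in> X \<and> j \<in> J}),
      lbracket = (\<lambda>X Y. {ladd L (lbracket L x y) j | x y j. x \<in> X \<and> y \<in> Y \<and> j \<in> J})\<rparr>"

definition generated_subalgebra ::
    "('k::field \<Rightarrow> 'a \<Rightarrow> 'a) \<Rightarrow> ('a \<Rightarrow> 'a \<Rightarrow> 'a) \<Rightarrow> 'a::ab_group_add set \<Rightarrow> 'a set" where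
  "generated_subalgebra sc br X =
     \<Inter>{S. module.subspace sc S \<and> (\<forall>x \<in> S. \<forall>y \<in> S. br x y \<in> S) \<and> X \<subseteq> S}"

definition finite_dim_simple_lie_algebra ::
    "('k::field \<Rightarrow> 'a \<Rightarrow> 'a) \<Rightarrow> ('a \<Rightarrow> 'a \<Rightarrow> 'a::ab_group_add) \<Rightarrow> bool" where
  "finite_dim_simple_lie_algebra sc br \<longleftrightarrow>
     lie_algebra (lie_of sc br) \<and>
     (\<exists>b. finite b \<and> module.span sc b = UNIV) \<and>
     (\<exists>x y. br x y \<noteq> 0) \<and>
     (\<forall>I. module.subspace sc I \<and> (\<forall>x. \<forall>y \<in> I. br x y \<in> I) \<longrightarrow> I = {0} \<or> I = UNIV)"


section \<open>Cartan matrices and Chevalley generators\<close>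

text \<open>Matrices are indexed by \<open>{0..l}\<close>, with 0 the affine node.\<close>

definition gen_cartan_matrix :: "nat \<Rightarrow> (nat \<Rightarrow> nat \<Rightarrow> int) \<Rightarrow> bool" where
  "gen_cartan_matrix l A \<longleftrightarrow>
     (\<forall>i \<le> l. A i i = 2) \<and>
     (\<forall>i \<le> l. \<forall>j \<le> l. i \<noteq> j \<longrightarrow> A i j \<le> 0) \<and>
     (\<forall>i \<le> l. \<forall>j \<le> l. A i j = 0 \<longrightarrow> A j i = 0)"

definition indecomposable :: "nat \<Rightarrow> (nat \<Rightarrow> nat \<Rightarrow> int) \<Rightarrow> bool" where
  "indecomposable l A \<longleftrightarrow>
     \<not> (\<exists>J. J \<noteq> {} \<and> J \<subset> {0..l} \<and> (\<forall>i \<in> J. \<forall>j \<in> {0..l} - J. A i j = 0 \<and> A j i = 0))"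

definition affine_type :: "nat \<Rightarrow> (nat \<Rightarrow> nat \<Rightarrow> int) \<Rightarrow> bool" where
  "affine_type l A \<longleftrightarrow>
     (\<exists>\<delta> :: nat \<Rightarrow> real. (\<forall>i \<le> l. \<delta> i > 0) \<and> (\<forall>i \<le> l. (\<Sum>j\<le>l. A i j * \<delta> j) = 0) \<and>
        (\<forall>v :: nat \<Rightarrow> real. (\<forall>i \<le> l. (\<Sum>j\<le>l. A i j * v j) = 0) \<longrightarrow> (\<exists>c. \<forall>i \<le> l. v i = c * \<delta> i))) \<and>
     (\<forall>v :: nat \<Rightarrow> real. (\<forall>i \<le> l. (\<Sum>j\<le>l. A i j * v j) \<ge> 0)
        \<longrightarrow> (\<forall>i \<le> l. (\<Sum>j\<le>l. A i j * v j) = 0))"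

definition chevalley_relations ::
    "('k::field \<Rightarrow> 'a \<Rightarrow> 'a) \<Rightarrow> ('a \<Rightarrow> 'a \<Rightarrow> 'a::ab_group_add) \<Rightarrow> nat set \<Rightarrow> (nat \<Rightarrow> nat \<Rightarrow> int)
      \<Rightarrow> (nat \<Rightarrow> 'a) \<Rightarrow> (nat \<Rightarrow> 'a) \<Rightarrow> (nat \<Rightarrow> 'a) \<Rightarrow> bool" where
  "chevalley_relations sc br I A e f h \<longleftrightarrow>
     (\<forall>i \<in> I. \<forall>j \<in> I.
        br (h i) (h j) = 0 \<and>
        br (e i) (f j) = (if i = j then h i else 0) \<and>
        br (h i) (e j) = sc (of_int (A i j)) (e j) \<and>
        br (h i) (f j) = - sc (of_int (A i j)) (f j))"

text \<open>A split finite-dimensional simple Lie algebra with Cartan matrix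
  \<open>(A i j)\<close>, \<open>1 \<le> i, j \<le> l\<close>, and Chevalley generators \<open>e i\<close>, \<open>f i\<close>.\<close>

definition split_simple ::
    "('k::field \<Rightarrow> 'a \<Rightarrow> 'a) \<Rightarrow> ('a \<Rightarrow> 'a \<Rightarrow> 'a::ab_group_add) \<Rightarrow> nat \<Rightarrow> (nat \<Rightarrow> nat \<Rightarrow> int)
      \<Rightarrow> (nat \<Rightarrow> 'a) \<Rightarrow> (nat \<Rightarrow> 'a) \<Rightarrow> (nat \<Rightarrow> 'a) \<Rightarrow> bool" where
  "split_simple sc br l A e f h \<longleftrightarrow>
     finite_dim_simple_lie_algebra sc br \<and>
     chevalley_relations sc br {1..l} A e f h \<and>
     generated_subalgebra sc br (e ` {1..l} \<union> f ` {1..l}) = UNIV"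

definition classical_cartan_chevalley ::
    "('k::field \<Rightarrow> 'a \<Rightarrow> 'a) \<Rightarrow> ('a \<Rightarrow> 'a \<Rightarrow> 'a::ab_group_add) \<Rightarrow> nat
      \<Rightarrow> (nat \<Rightarrow> 'a) \<Rightarrow> (nat \<Rightarrow> 'a) \<Rightarrow> (nat \<Rightarrow> 'a) \<Rightarrow> ('a \<Rightarrow> 'a) \<Rightarrow> bool" where
  "classical_cartan_chevalley sc br l e f h \<omega> \<longleftrightarrow>
     lie_hom \<omega> (lie_of sc br) (lie_of sc br) \<and>
     (\<forall>i \<in> {1..l}. \<omega> (e i) = - f i \<and> \<omega> (f i) = - e i \<and> \<omega> (h i) = - h i)"

text \<open>\<open>A\<close> is the extended Cartan matrix of the simple Lie algebra. The relations for the indices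
  \<open>0\<close> and \<open>i \<in> {1..l}\<close> say that \<open>f 0\<close> is killed by all \<open>e i\<close> and \<open>e 0\<close> by all \<open>f i\<close>, so
  \<open>f 0\<close> and \<open>e 0\<close> are root vectors for the highest root \<open>\<theta>\<close> and for \<open>-\<theta>\<close>, and \<open>h 0\<close> is minus
  the coroot of \<open>\<theta>\<close>; row and column 0 of \<open>A\<close> are then those of the extended Cartan matrix.
  The condition \<open>f 0 = - \<omega> (e 0)\<close> normalises the two root vectors relative to each other.\<close>

definition extended_cartan_matrix ::
    "('k::field \<Rightarrow> 'a \<Rightarrow> 'a) \<Rightarrow> ('a \<Rightarrow> 'a \<Rightarrow> 'a::ab_group_add) \<Rightarrow> nat \<Rightarrow> (nat \<Rightarrow> nat \<Rightarrow> int)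
      \<Rightarrow> (nat \<Rightarrow> 'a) \<Rightarrow> (nat \<Rightarrow> 'a) \<Rightarrow> (nat \<Rightarrow> 'a) \<Rightarrow> ('a \<Rightarrow> 'a) \<Rightarrow> bool" where
  "extended_cartan_matrix sc br l A e f h \<omega> \<longleftrightarrow>
     chevalley_relations sc br {0..l} A e f h \<and> f 0 = - \<omega> (e 0)"

definition invariant_form ::
    "('k::field \<Rightarrow> 'a \<Rightarrow> 'a) \<Rightarrow> ('a \<Rightarrow> 'a \<Rightarrow> 'a::ab_group_add) \<Rightarrow> ('a \<Rightarrow> 'a \<Rightarrow> 'k) \<Rightarrow> bool" where
  "invariant_form sc br B \<longleftrightarrow>
     (\<forall>x y z. B (x + y) z = B x z + B y z) \<and>
     (\<forall>c x y. B (sc c x) y = c * B x y) \<and>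
     (\<forall>x y. B x y = B y x) \<and>
     (\<forall>x y z. B (br x y) z = B x (br y z)) \<and>
     (\<forall>x. x \<noteq> 0 \<longrightarrow> (\<exists>y. B x y \<noteq> 0))"

definition plus_eigenspace :: "('a \<Rightarrow> 'a) \<Rightarrow> 'a set" where
  "plus_eigenspace \<omega> = {x. \<omega> x = x}"

definition minus_eigenspace :: "('a \<Rightarrow> 'a::ab_group_add) \<Rightarrow> 'a set" where
  "minus_eigenspace \<omega> = {x. \<omega> x = - x}"


section \<open>The untwisted affine Kac--Moody algebra\<close>

text \<open>Laurent polynomials are finitely supported functions on \<open>int\<close> (with the convolution product
  of the library); \<open>tpow n\<close> is \<open>t\<close> to the power \<open>n\<close>. The tensor product of the Laurent polynomials
  with a vector space \<open>V\<close> is represented by the finitely supported functions from \<open>int\<close> to \<open>V\<close>,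
  where \<open>P \<otimes> x\<close> has the coefficients of \<open>P\<close> times \<open>x\<close>.\<close>

definition tpow :: "int \<Rightarrow> (int \<Rightarrow>\<^sub>0 'k::comm_ring_1)" where
  "tpow n = Poly_Mapping.single n 1"

definition loop_tensor ::
    "('k::comm_ring_1 \<Rightarrow> 'a \<Rightarrow> 'a) \<Rightarrow> (int \<Rightarrow>\<^sub>0 'k) \<Rightarrow> 'a \<Rightarrow> (int \<Rightarrow>\<^sub>0 'a::ab_group_add)" where
  "loop_tensor sc P x = (\<Sum>n \<in> Poly_Mapping.keys P. Poly_Mapping.single n (sc (Poly_Mapping.lookup P n) x))"

definition loop_scale ::
    "('k \<Rightarrow> 'a \<Rightarrow> 'a) \<Rightarrow> 'k \<Rightarrow> (int \<Rightarrow>\<^sub>0 'a) \<Rightarrow> (int \<Rightarrow>\<^sub>0 'a::ab_group_add)" where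
  "loop_scale sc c F = (\<Sum>n \<in> Poly_Mapping.keys F. Poly_Mapping.single n (sc c (Poly_Mapping.lookup F n)))"

definition loop_bracket ::
    "('a \<Rightarrow> 'a \<Rightarrow> 'a) \<Rightarrow> (int \<Rightarrow>\<^sub>0 'a) \<Rightarrow> (int \<Rightarrow>\<^sub>0 'a) \<Rightarrow> (int \<Rightarrow>\<^sub>0 'a::ab_group_add)" where
  "loop_bracket br F G =
     (\<Sum>m \<in> Poly_Mapping.keys F. \<Sum>n \<in> Poly_Mapping.keys G.
        Poly_Mapping.single (m + n) (br (Poly_Mapping.lookup F m) (Poly_Mapping.lookup G n)))"

definition loop_degree ::
    "('k::comm_ring_1 \<Rightarrow> 'a \<Rightarrow> 'a) \<Rightarrow> (int \<Rightarrow>\<^sub>0 'a) \<Rightarrow> (int \<Rightarrow>\<^sub>0 'a::ab_group_add)" where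
  "loop_degree sc F =
     (\<Sum>n \<in> Poly_Mapping.keys F. Poly_Mapping.single n (sc (of_int n) (Poly_Mapping.lookup F n)))"

definition loop_cocycle :: "('a \<Rightarrow> 'a \<Rightarrow> 'k) \<Rightarrow> (int \<Rightarrow>\<^sub>0 'a) \<Rightarrow> (int \<Rightarrow>\<^sub>0 'a::zero) \<Rightarrow> 'k::comm_ring_1" where
  "loop_cocycle B F G = (\<Sum>n \<in> Poly_Mapping.keys F. of_int n * B (Poly_Mapping.lookup F n) (Poly_Mapping.lookup G (- n)))"

lemma lookup_loop_tensor:
  assumes "lie_algebra (lie_of sc br)"
  shows "Poly_Mapping.lookup (loop_tensor sc P x) n = sc (Poly_Mapping.lookup P n) x"
proof -
  interpret lie_algebra "lie_of sc br" by fact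
  have sc0: "sc 0 z = 0" for z
    using add_scale[of z 0 0] by (simp add: lie_of_def)
  show ?thesis
    by (auto simp: loop_tensor_def lookup_sum lookup_single when_def sc0 in_keys_iff)
qed

lemma loop_bracket_tensor:
  assumes "lie_algebra (lie_of sc br)"
  shows "loop_bracket br (loop_tensor sc P x) (loop_tensor sc Q y) = loop_tensor sc (P * Q) (br x y)"
proof -
  interpret lie_algebra "lie_of sc br" by fact
  note look = lookup_loop_tensor[OF assms]
  have sc0: "sc 0 z = 0" for z
    using add_scale[of z 0 0] by (simp add: lie_of_def)
  have br_sc: "br (sc c x) (sc d y) = sc (c * d) (br x y)" for c d
    using bracket_scale_left bracket_scale_right scale_scale by (simp add: lie_of_def mult.commute)
  have tadd: "loop_tensor sc (R + S) z = loop_tensor sc R z + loop_tensor sc S z" for R S z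
    using add_scale by (intro poly_mapping_eqI) (simp add: look lookup_add lie_of_def)
  have t0: "loop_tensor sc 0 z = 0" for z
    by (intro poly_mapping_eqI) (simp add: look sc0)
  have tsum: "loop_tensor sc (\<Sum>i\<in>T. R i) z = (\<Sum>i\<in>T. loop_tensor sc (R i) z)"
    if "finite T" for T :: "int set" and R z
    using that by induction (simp_all add: tadd t0)
  have tsingle: "loop_tensor sc (Poly_Mapping.single n c) z = Poly_Mapping.single n (sc c z)" for n c z
    by (intro poly_mapping_eqI) (simp add: look lookup_single when_def sc0)
  have mono: "(\<Sum>n \<in> Poly_Mapping.keys R. Poly_Mapping.single n (Poly_Mapping.lookup R n)) = R"
    for R :: "int \<Rightarrow>\<^sub>0 'a"
    by (intro poly_mapping_eqI) (auto simp: lookup_sum lookup_single when_def in_keys_iff)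
  have sub: "Poly_Mapping.keys (loop_tensor sc R z) \<subseteq> Poly_Mapping.keys R" for R z
    by (auto simp: in_keys_iff look sc0)
  have br0: "br 0 z = 0" "br z 0 = 0" for z
    using bracket_add_left[of 0 0 z] bracket_add_right[of z 0 0] by (simp_all add: lie_of_def)
  have "loop_bracket br (loop_tensor sc P x) (loop_tensor sc Q y) =
     (\<Sum>m \<in> Poly_Mapping.keys P. \<Sum>n \<in> Poly_Mapping.keys Q.
        Poly_Mapping.single (m + n) (br (sc (Poly_Mapping.lookup P m) x) (sc (Poly_Mapping.lookup Q n) y)))"
    unfolding loop_bracket_def look
    by (rule sum.mono_neutral_cong_left[OF finite_keys sub])
       (auto simp: in_keys_iff look br0
             intro!: sum.neutral sum.mono_neutral_cong_left[OF finite_keys sub])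
  also have "\<dots> = loop_tensor sc (\<Sum>m \<in> Poly_Mapping.keys P. \<Sum>n \<in> Poly_Mapping.keys Q.
        Poly_Mapping.single m (Poly_Mapping.lookup P m) *
        Poly_Mapping.single n (Poly_Mapping.lookup Q n)) (br x y)"
    by (simp add: tsum tsingle mult_single br_sc)
  also have "\<dots> = loop_tensor sc (P * Q) (br x y)"
    by (simp add: sum_product[symmetric] mono)
  finally show ?thesis .
qed

text \<open>The Kac--Moody algebra: the triple \<open>(F, a, b)\<close> stands for \<open>F + a c + b d\<close>, where \<open>c\<close> is
  central and \<open>d = t d/dt\<close>. Rescaling the form \<open>B\<close> amounts to rescaling \<open>c\<close>.\<close>

type_synonym ('k, 'a) affine = "(int \<Rightarrow>\<^sub>0 'a) \<times> 'k \<times> 'k"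

definition affine_algebra ::
    "('k::field \<Rightarrow> 'a \<Rightarrow> 'a) \<Rightarrow> ('a \<Rightarrow> 'a \<Rightarrow> 'a::ab_group_add) \<Rightarrow> ('a \<Rightarrow> 'a \<Rightarrow> 'k)
      \<Rightarrow> ('k, ('k, 'a) affine) lie_struct" where
  "affine_algebra sc br B = lie_of
     (\<lambda>s (F, a, b). (loop_scale sc s F, s * a, s * b))
     (\<lambda>(F, a, b) (G, a', b').
        (loop_bracket br F G + loop_scale sc b (loop_degree sc G) - loop_scale sc b' (loop_degree sc F),
         loop_cocycle B F G, 0))"

definition in_affine :: "(int \<Rightarrow>\<^sub>0 'a) \<Rightarrow> ('k::zero, 'a::ab_group_add) affine" where
  "in_affine F = (F, 0, 0)"

definition affine_e ::
    "('k::field \<Rightarrow> 'a \<Rightarrow> 'a) \<Rightarrow> (nat \<Rightarrow> 'a) \<Rightarrow> nat \<Rightarrow> ('k, 'a::ab_group_add) affine" where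
  "affine_e sc e i = in_affine (loop_tensor sc (tpow (if i = 0 then 1 else 0)) (e i))"

definition affine_f ::
    "('k::field \<Rightarrow> 'a \<Rightarrow> 'a) \<Rightarrow> (nat \<Rightarrow> 'a) \<Rightarrow> nat \<Rightarrow> ('k, 'a::ab_group_add) affine" where
  "affine_f sc f i = in_affine (loop_tensor sc (tpow (if i = 0 then -1 else 0)) (f i))"

definition affine_cartan ::
    "('k::field \<Rightarrow> 'a \<Rightarrow> 'a) \<Rightarrow> nat \<Rightarrow> (nat \<Rightarrow> 'a) \<Rightarrow> ('k, 'a::ab_group_add) affine set" where
  "affine_cartan sc l h =
     {(loop_tensor sc (tpow 0) x, a, b) | x a b. x \<in> module.span sc (h ` {1..l})}"

definition cartan_chevalley ::
    "('k::field \<Rightarrow> 'a \<Rightarrow> 'a) \<Rightarrow> ('a \<Rightarrow> 'a \<Rightarrow> 'a::ab_group_add) \<Rightarrow> ('a \<Rightarrow> 'a \<Rightarrow> 'k) \<Rightarrow> nat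
      \<Rightarrow> (nat \<Rightarrow> 'a) \<Rightarrow> (nat \<Rightarrow> 'a) \<Rightarrow> (nat \<Rightarrow> 'a) \<Rightarrow> (('k, 'a) affine \<Rightarrow> ('k, 'a) affine) \<Rightarrow> bool" where
  "cartan_chevalley sc br B l e f h \<Omega> \<longleftrightarrow>
     lie_hom \<Omega> (affine_algebra sc br B) (affine_algebra sc br B) \<and>
     (\<forall>i \<in> {0..l}. \<Omega> (affine_e sc e i) = - affine_f sc f i \<and>
                   \<Omega> (affine_f sc f i) = - affine_e sc e i) \<and>
     (\<forall>z \<in> affine_cartan sc l h. \<Omega> z = - z)"

definition fixed_subalgebra ::
    "('k, 'a) lie_struct \<Rightarrow> ('a \<Rightarrow> 'a) \<Rightarrow> ('k, 'a) lie_struct" where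
  "fixed_subalgebra L \<Omega> = lie_restrict L {z \<in> lcarrier L. \<Omega> z = z}"


section \<open>Formal power series with coefficients in a Lie algebra\<close>

text \<open>The tensor product of \<open>\<bbbK>[[u]]\<close> with a vector space \<open>V\<close> embeds into the sequences in \<open>V\<close>;
  it is represented by the span of the sequences \<open>P \<otimes> x\<close>. All subspaces spanned by pure tensors
  are formed in the same way.\<close>

definition series_scale :: "('k \<Rightarrow> 'a \<Rightarrow> 'a) \<Rightarrow> 'k \<Rightarrow> (nat \<Rightarrow> 'a) \<Rightarrow> (nat \<Rightarrow> 'a)" where
  "series_scale sc c F = (\<lambda>n. sc c (F n))"

definition series_tensor :: "('k::field \<Rightarrow> 'a \<Rightarrow> 'a) \<Rightarrow> 'k fps \<Rightarrow> 'a \<Rightarrow> (nat \<Rightarrow> 'a)" where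
  "series_tensor sc P x = (\<lambda>n. sc (fps_nth P n) x)"

definition tensor_space ::
    "('k::field \<Rightarrow> 'a \<Rightarrow> 'a) \<Rightarrow> 'k fps set \<Rightarrow> 'a::ab_group_add set \<Rightarrow> (nat \<Rightarrow> 'a) set" where
  "tensor_space sc R V = module.span (series_scale sc) {series_tensor sc P x | P x. P \<in> R \<and> x \<in> V}"

definition series_bracket ::
    "('a \<Rightarrow> 'a \<Rightarrow> 'a::ab_group_add) \<Rightarrow> (nat \<Rightarrow> 'a) \<Rightarrow> (nat \<Rightarrow> 'a) \<Rightarrow> (nat \<Rightarrow> 'a)" where
  "series_bracket br F G = (\<lambda>n. \<Sum>i\<le>n. br (F i) (G (n - i)))"

definition series_algebra ::
    "('k::field \<Rightarrow> 'a \<Rightarrow> 'a) \<Rightarrow> ('a \<Rightarrow> 'a \<Rightarrow> 'a::ab_group_add) \<Rightarrow> ('k, nat \<Rightarrow> 'a) lie_struct" where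
  "series_algebra sc br =
     lie_restrict (lie_of (series_scale sc) (series_bracket br)) (tensor_space sc UNIV UNIV)"

definition even_series :: "'k::field fps set" where
  "even_series = {P. \<forall>n. odd n \<longrightarrow> fps_nth P n = 0}"

definition odd_series :: "'k::field fps set" where
  "odd_series = {P. \<forall>n. even n \<longrightarrow> fps_nth P n = 0}"

definition N_series ::
    "('k::field \<Rightarrow> 'a \<Rightarrow> 'a) \<Rightarrow> ('a \<Rightarrow> 'a \<Rightarrow> 'a::ab_group_add) \<Rightarrow> ('a \<Rightarrow> 'a)
      \<Rightarrow> ('k, nat \<Rightarrow> 'a) lie_struct" where
  "N_series sc br \<omega> = lie_restrict (series_algebra sc br)
     {F + G | F G. F \<in> tensor_space sc even_series (plus_eigenspace \<omega>) \<and>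
                   G \<in> tensor_space sc odd_series (minus_eigenspace \<omega>)}"

text \<open>With \<open>I\<close> the ideal generated by \<open>u^(N+1)\<close>, the tensor product of \<open>\<bbbK>[[u]] / I\<close> with a vector
  space \<open>V\<close> is represented as \<open>(\<bbbK>[[u]] \<otimes> V) / (I \<otimes> V)\<close>; the pure tensor of the class of \<open>P\<close> with
  \<open>x\<close> is the class of \<open>P \<otimes> x\<close>.\<close>

definition trunc_ideal :: "nat \<Rightarrow> 'k::field fps set" where
  "trunc_ideal N = {fps_X ^ (N + 1) * Q | Q. True}"

definition trunc_proj ::
    "('k::field \<Rightarrow> 'a \<Rightarrow> 'a) \<Rightarrow> ('a \<Rightarrow> 'a \<Rightarrow> 'a::ab_group_add) \<Rightarrow> nat \<Rightarrow> (nat \<Rightarrow> 'a) \<Rightarrow> (nat \<Rightarrow> 'a) set" where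
  "trunc_proj sc br N = lie_coset (series_algebra sc br) (tensor_space sc (trunc_ideal N) UNIV)"

definition trunc_algebra ::
    "('k::field \<Rightarrow> 'a \<Rightarrow> 'a) \<Rightarrow> ('a \<Rightarrow> 'a \<Rightarrow> 'a::ab_group_add) \<Rightarrow> nat
      \<Rightarrow> ('k, (nat \<Rightarrow> 'a) set) lie_struct" where
  "trunc_algebra sc br N =
     lie_quotient (series_algebra sc br) (tensor_space sc (trunc_ideal N) UNIV)"

definition N_trunc ::
    "('k::field \<Rightarrow> 'a \<Rightarrow> 'a) \<Rightarrow> ('a \<Rightarrow> 'a \<Rightarrow> 'a::ab_group_add) \<Rightarrow> ('a \<Rightarrow> 'a) \<Rightarrow> nat
      \<Rightarrow> ('k, (nat \<Rightarrow> 'a) set) lie_struct" where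
  "N_trunc sc br \<omega> N = lie_restrict (trunc_algebra sc br N)
     {ladd (trunc_algebra sc br N) X Y | X Y.
        X \<in> trunc_proj sc br N ` tensor_space sc even_series (plus_eigenspace \<omega>) \<and>
        Y \<in> trunc_proj sc br N ` tensor_space sc odd_series (minus_eigenspace \<omega>)}"

lemma series_bracket_tensor:
  assumes "lie_algebra (lie_of sc br)"
  shows "series_bracket br (series_tensor sc P x) (series_tensor sc Q y)
           = series_tensor sc (P * Q) (br x y)"
proof
  fix n
  interpret lie_algebra "lie_of sc br" by fact
  have sc0: "sc 0 z = 0" for z
    using add_scale[of z 0 0] by (simp add: lie_of_def)
  have sum_sc: "sc (\<Sum>i\<in>S. c i) z = (\<Sum>i\<in>S. sc (c i) z)" if "finite S" for S :: "nat set" and c z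
    using that by induction (use sc0 add_scale in \<open>simp_all add: lie_of_def\<close>)
  have "br (sc c x) (sc d y) = sc (c * d) (br x y)" for c d
    using bracket_scale_left bracket_scale_right scale_scale by (simp add: lie_of_def mult.commute)
  thus "series_bracket br (series_tensor sc P x) (series_tensor sc Q y) n
           = series_tensor sc (P * Q) (br x y) n"
    by (simp add: series_bracket_def series_tensor_def fps_mult_nth sum_sc atLeast0AtMost)
qed


section \<open>The coefficients\<close>

text \<open>Binomial coefficients with the conventions for lower arguments \<open>j \<le> 0\<close>. In the coefficients
  below, the upper argument is negative only for \<open>n = 0\<close> and \<open>j \<le> 0\<close>.\<close>

definition binom :: "int \<Rightarrow> int \<Rightarrow> int" where
  "binom m j = (if j < 0 then 0 else if j = 0 then 1 else int (nat m choose nat j))"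

definition coeff_even :: "nat \<Rightarrow> nat \<Rightarrow> int" where
  "coeff_even n k =
     2 * (\<Sum>i = 0..n. binom (2 * int n) (2 * int i) * binom (int k - int i + int n - 1) (int k - int i))"

definition coeff_odd :: "nat \<Rightarrow> nat \<Rightarrow> int" where
  "coeff_odd n k =
     - 2 * (\<Sum>i = 0..<n. binom (2 * int n) (2 * int i + 1)
                           * binom (int k - int i + int n - 1) (int k - int i))"

definition plus_series :: "nat \<Rightarrow> 'k::field fps" where
  "plus_series n = Abs_fps (\<lambda>m. if even m then of_int (coeff_even n (m div 2)) else 0)"

definition minus_series :: "nat \<Rightarrow> 'k::field fps" where
  "minus_series n = Abs_fps (\<lambda>m. if odd m then of_int (coeff_odd n (m div 2)) else 0)"

text \<open>A linear map on the fixed subalgebra with the prescribed values on the elements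
  \<open>(t^n + t^(-n)) \<otimes> x\<close> and \<open>(t^n - t^(-n)) \<otimes> y\<close>; the sign \<open>s\<close> is 1 or -1.\<close>

definition is_rho ::
    "('k::field \<Rightarrow> 'a \<Rightarrow> 'a) \<Rightarrow> ('a \<Rightarrow> 'a \<Rightarrow> 'a::ab_group_add) \<Rightarrow> ('a \<Rightarrow> 'a) \<Rightarrow> 'k
      \<Rightarrow> ('k, ('k, 'a) affine) lie_struct \<Rightarrow> (('k, 'a) affine \<Rightarrow> nat \<Rightarrow> 'a) \<Rightarrow> bool" where
  "is_rho sc br \<omega> s \<kk> \<rho> \<longleftrightarrow>
     linear_between \<rho> \<kk> (N_series sc br \<omega>) \<and>
     (\<forall>n :: nat. \<forall>x \<in> plus_eigenspace \<omega>.
        \<rho> (in_affine (loop_tensor sc (tpow (int n) + tpow (- int n)) x))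
          = series_tensor sc (fps_const (s ^ n) * plus_series n) x) \<and>
     (\<forall>n :: nat. \<forall>y \<in> minus_eigenspace \<omega>.
        \<rho> (in_affine (loop_tensor sc (tpow (int n) - tpow (- int n)) y))
          = series_tensor sc (fps_const (s ^ n) * minus_series n) y)"

end

theory Submission
  imports Defs
begin

text \<open>
  The idea is to expand a loop around the fixed points \<open>t = \<plusminus>1\<close> of \<open>t \<mapsto> 1 / t\<close>, in the coordinate
  \<open>u\<close> with \<open>t = s (1 - u) / (1 + u)\<close>, \<open>s = \<plusminus>1\<close>, in which this involution becomes \<open>u \<mapsto> - u\<close>. The
  expansion is a homomorphism from the Laurent polynomials to the power series, because it is a
  substitution, and it extends to a Lie homomorphism from the loop algebra to the series with
  coefficients in the simple Lie algebra (\<open>loop_eval_bracket\<close>). The numbers in the statement are the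
  coefficients of this expansion for \<open>t^n \<plusminus> t^(-n)\<close> (\<open>cayley_power_plus_minus\<close>). So the map
  sought is the restriction of the expansion to the fixed subalgebra.

  To know the fixed subalgebra, one has to know \<open>\<Omega>\<close> beyond the generators. As \<open>\<Omega>\<close> negates the
  derivation \<open>d\<close>, it reverses the grading, and since the simple Lie algebra is perfect, neither the
  centre nor \<open>d\<close> occurs in the image of a loop. Agreement with \<open>t^n \<otimes> x \<mapsto> t^(-n) \<otimes> \<omega> x\<close> spreads from
  the generators to all constant loops, then to degrees \<open>\<plusminus>1\<close>, where it holds on an ideal that
  contains the root vector of the affine node, and then by perfectness to all degrees
  (\<open>\<Omega>_eq\<close>). The root vector is not zero because the matrix is indecomposable. The fixed subalgebra
  therefore consists of the loops that are invariant under this reflection, and their expansions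
  are the series whose even coefficients lie in the \<open>+1\<close> eigenspace and whose odd ones lie in the
  \<open>-1\<close> eigenspace of \<open>\<omega>\<close> (\<open>loop_eval_parity\<close>). As the simple Lie algebra has finite dimension,
  every series with this parity is a finite sum of pure tensors (\<open>tensor_space_eq\<close>).

  Injectivity and the failure of surjectivity have a common cause. The operator \<open>t d/dt\<close> has the
  eigenvectors \<open>t^n\<close> with distinct eigenvalues, and in the coordinate \<open>u\<close> it is a difference
  operator that involves neighbouring coefficients only. Hence a loop without constant term whose
  expansion vanishes on a sufficiently long interval of indices is zero (\<open>loop_eval_gap\<close>). Applied at
  the beginning of the series this gives injectivity; applied in the gaps of a lacunary series it
  shows that such a series is not the expansion of a loop.

  After truncation the obstruction disappears: \<open>(t - s)^N\<close> vanishes to order exactly \<open>N\<close> at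
  \<open>u = 0\<close>, so any finite number of coefficients can be prescribed (\<open>loop_eval_dense\<close>), and
  averaging with the reflection makes the loop invariant without changing coefficients that
  already have the right parity (\<open>loop_reflect_dense\<close>).
\<close>

unbundle fps_syntax

section \<open>Powers of the Cayley transform\<close>

text \<open>The \<open>n\<close>-th power of \<open>s (1 - u) / (1 + u)\<close>, for an integer \<open>n\<close>. For \<open>s = \<plusminus>1\<close> the second branch is
  the inverse of the first one, written out because the power series do not form a field.\<close>

definition cayley_power :: "'k::field \<Rightarrow> int \<Rightarrow> 'k fps" where
  "cayley_power s n =
     (if n \<ge> 0 then (fps_const s * ((1 - fps_X) * inverse (1 + fps_X))) ^ nat n
      else (fps_const s * ((1 + fps_X) * inverse (1 - fps_X))) ^ nat (- n))"

lemma inverse_one_plus_minus_X: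
  "(1 + fps_X) * inverse (1 + fps_X :: 'k::field fps) = 1"
  "(1 - fps_X) * inverse (1 - fps_X :: 'k::field fps) = 1"
  by (simp_all add: inverse_mult_eq_1')

lemma cayley_power_0 [simp]: "cayley_power s 0 = 1"
  by (simp add: cayley_power_def)

text \<open>The condition \<open>s * s = 1\<close> makes \<open>s (1 - u) / (1 + u)\<close> and \<open>s (1 + u) / (1 - u)\<close> inverse to each
  other.\<close>

lemma cayley_power_add:
  fixes s :: "'k::field"
  assumes "s * s = 1"
  shows "cayley_power s (m + n) = cayley_power s m * cayley_power s n"
proof -
  define q where "q = fps_const s * ((1 - fps_X) * inverse (1 + fps_X :: 'k fps))"
  define q' where "q' = fps_const s * ((1 + fps_X) * inverse (1 - fps_X :: 'k fps))"
  have "q * q' = fps_const (s * s) * (((1 + fps_X) * inverse (1 + fps_X)) * ((1 - fps_X) * inverse (1 - fps_X)))"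
    unfolding q_def q'_def by (simp only: fps_const_mult[symmetric] ac_simps)
  hence qq': "q * q' = 1"
    using assms by (simp add: inverse_one_plus_minus_X)
  have cp: "cayley_power s k = (if k \<ge> 0 then q ^ nat k else q' ^ nat (- k))" for k
    by (simp add: cayley_power_def q_def q'_def)
  have cancel: "q ^ (a + b) * q' ^ b = q ^ a" "q' ^ (a + b) * q ^ b = q' ^ a" for a b
    using qq' by (simp_all add: power_add mult.assoc power_mult_distrib[symmetric] mult.commute)
  have step: "cayley_power s (int a - int b) = q ^ a * q' ^ b" for a b
  proof (cases "a \<ge> b")
    case True
    thus ?thesis
      using cancel(1)[of "a - b" b] by (simp add: cp nat_diff_distrib)
  next
    case False
    thus ?thesis
      using cancel(2)[of "b - a" a] by (simp add: cp nat_diff_distrib mult.commute)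
  qed
  have "m = int (nat m) - int (nat (- m))" "n = int (nat n) - int (nat (- n))"
    by simp_all
  moreover have "m + n = int (nat m + nat n) - int (nat (- m) + nat (- n))"
    by simp
  ultimately show ?thesis
    using step by (metis (no_types, lifting) power_add mult.assoc mult.left_commute)
qed

text \<open>Multiplying numerator and denominator by the conjugate factor gives \<open>t^n\<close> and \<open>t^(-n)\<close> the common
  denominator \<open>(1 - u^2)^n\<close>; the binomials in the coefficients come from this form.\<close>

lemma cayley_power_of_nat:
  fixes s :: "'k::field"
  shows "cayley_power s (int n) = fps_const (s ^ n) * (1 - fps_X) ^ (2 * n) * inverse (1 - fps_X ^ 2) ^ n"
    and "cayley_power s (- int n) = fps_const (s ^ n) * (1 + fps_X) ^ (2 * n) * inverse (1 - fps_X ^ 2) ^ n"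
proof -
  have "(1 - fps_X ^ 2 :: 'k fps) = (1 - fps_X) * (1 + fps_X)"
    by (simp add: algebra_simps power2_eq_square)
  hence inv: "inverse (1 - fps_X ^ 2 :: 'k fps) = inverse (1 - fps_X) * inverse (1 + fps_X)"
    by (simp add: fps_inverse_mult)
  have "(1 - fps_X) * inverse (1 + fps_X) = (1 - fps_X :: 'k fps) ^ 2 * inverse (1 - fps_X ^ 2)"
  proof -
    have "(1 - fps_X :: 'k fps) ^ 2 * inverse (1 - fps_X ^ 2)
       = ((1 - fps_X) * inverse (1 - fps_X)) * ((1 - fps_X) * inverse (1 + fps_X))"
      unfolding inv by (simp only: power2_eq_square ac_simps)
    thus ?thesis by (simp add: inverse_one_plus_minus_X)
  qed
  thus "cayley_power s (int n) = fps_const (s ^ n) * (1 - fps_X) ^ (2 * n) * inverse (1 - fps_X ^ 2) ^ n"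
    by (simp add: cayley_power_def power_mult_distrib fps_const_power power_mult mult.assoc)
  have "(1 + fps_X) * inverse (1 - fps_X) = (1 + fps_X :: 'k fps) ^ 2 * inverse (1 - fps_X ^ 2)"
  proof -
    have "(1 + fps_X :: 'k fps) ^ 2 * inverse (1 - fps_X ^ 2)
       = ((1 + fps_X) * inverse (1 + fps_X)) * ((1 + fps_X) * inverse (1 - fps_X))"
      unfolding inv by (simp only: power2_eq_square ac_simps)
    thus ?thesis by (simp add: inverse_one_plus_minus_X)
  qed
  thus "cayley_power s (- int n) = fps_const (s ^ n) * (1 + fps_X) ^ (2 * n) * inverse (1 - fps_X ^ 2) ^ n"
    by (cases "n = 0") (simp_all add: cayley_power_def power_mult_distrib fps_const_power power_mult mult.assoc)
qed

text \<open>The number of multisets of size \<open>j\<close> on \<open>n\<close> points.\<close>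

definition multichoose :: "nat \<Rightarrow> nat \<Rightarrow> nat" where
  "multichoose n j = (j + n - 1) choose j"

lemma multichoose_pascal: "multichoose (Suc n) (Suc j) = multichoose (Suc n) j + multichoose n (Suc j)"
  by (cases j) (simp_all add: multichoose_def)

lemma inverse_one_minus_X_squared_power:
  "inverse (1 - fps_X ^ 2 :: 'k::field fps) ^ n
     = Abs_fps (\<lambda>m. if even m then of_nat (multichoose n (m div 2)) else 0)"
  (is "_ = ?A n")
proof (induction n)
  case 0
  show ?case
    by (rule fps_ext) (auto simp: multichoose_def binomial_eq_0 elim!: evenE)
next
  case (Suc n)
  \<comment> \<open>Coefficientwise this is Pascal's rule.\<close>
  have "(1 - fps_X ^ 2) * ?A (Suc n) = ?A n"
  proof (rule fps_ext)
    fix m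
    consider "m = 0" | "m = 1" | j where "m = Suc (Suc j)"
      by (metis One_nat_def not0_implies_Suc)
    thus "((1 - fps_X ^ 2) * ?A (Suc n)) $ m = ?A n $ m"
    proof cases
      case 3
      have "((1 - fps_X ^ 2) * ?A (Suc n)) $ m = ?A (Suc n) $ m - ?A (Suc n) $ j"
        by (simp add: left_diff_distrib fps_X_power_mult_nth 3)
      thus ?thesis
        by (auto simp: 3 multichoose_pascal)
    qed (auto simp: left_diff_distrib fps_X_power_mult_nth multichoose_def)
  qed
  hence "inverse (1 - fps_X ^ 2) * ?A n = (inverse (1 - fps_X ^ 2) * (1 - fps_X ^ 2)) * ?A (Suc n)"
    by (simp only: mult.assoc)
  also have "\<dots> = ?A (Suc n)"
    by (simp add: inverse_mult_eq_1)
  finally show ?case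
    by (simp add: Suc.IH)
qed

lemma one_plus_X_power_nth: "((1 + fps_X) ^ m :: 'k::field fps) $ k = of_nat (m choose k)"
  by (induction m arbitrary: k)
     (auto simp: distrib_right fps_X_mult_nth fps_one_nth gr0_conv_Suc binomial_Suc_Suc split: if_splits)

lemma one_minus_X_power_nth: "((1 - fps_X) ^ m :: 'k::field fps) $ k = (-1) ^ k * of_nat (m choose k)"
proof (induction m arbitrary: k)
  case (Suc m)
  show ?case
    by (cases k) (simp_all add: left_diff_distrib fps_X_mult_nth Suc algebra_simps)
qed (auto simp: fps_one_nth binomial_eq_0)

lemma sum_upto_even:
  fixes f :: "nat \<Rightarrow> 'k::comm_monoid_add"
  assumes "\<And>i. odd i \<Longrightarrow> f i = 0"
  shows "(\<Sum>i=0..2*k. f i) = (\<Sum>i=0..k. f (2 * i))"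
  by (induction k) (auto simp: assms)

lemma sum_upto_odd:
  fixes f :: "nat \<Rightarrow> 'k::comm_monoid_add"
  assumes "\<And>i. even i \<Longrightarrow> f i = 0"
  shows "(\<Sum>i=0..2*k+1. f i) = (\<Sum>i=0..k. f (2 * i + 1))"
  by (induction k) (auto simp: assms)

lemma binom_int: "binom (int a) (int b) = int (a choose b)"
  by (simp add: binom_def)

lemma binom_multichoose:
  "binom (int k - int i + int n - 1) (int k - int i) = (if i \<le> k then int (multichoose n (k - i)) else 0)"
proof -
  have "nat (int k - int i + int n - 1) = k - i + n - 1" if "i < k" using that by linarith
  moreover have "nat (int k - int i) = k - i" by linarith
  ultimately show ?thesis
    by (auto simp: binom_def multichoose_def)
qed

text \<open>The defining sums of the coefficients stop at \<open>n\<close> or \<open>n - 1\<close>, while a Cauchy product stops at \<open>k\<close>. Beyond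
  either bound one of the two binomial factors vanishes.\<close>

lemma sum_choose_multichoose:
  assumes "\<And>i. i \<ge> b \<Longrightarrow> N choose (g i) = 0"
  shows "(\<Sum>i=0..<b. binom (int N) (int (g i)) * binom (int k - int i + int n - 1) (int k - int i))
       = (\<Sum>i=0..k. int (N choose g i) * int (multichoose n (k - i)))"
proof -
  have "(\<Sum>i=0..<b. binom (int N) (int (g i)) * binom (int k - int i + int n - 1) (int k - int i))
      = (\<Sum>i\<in>{0..<b} \<inter> {0..k}. int (N choose g i) * int (multichoose n (k - i)))"
    by (intro sum.mono_neutral_cong_right) (auto simp: binom_int binom_multichoose)
  also have "\<dots> = (\<Sum>i=0..k. int (N choose g i) * int (multichoose n (k - i)))"

  proof (intro sum.mono_neutral_left ballI)
    fix i assume "i \<in> {0..k} - {0..<b} \<inter> {0..k}"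
    thus "int (N choose g i) * int (multichoose n (k - i)) = 0"
      using assms[of i] by (cases "i < b") auto
  qed auto
  finally show ?thesis .
qed

lemma coeff_even_eq:
  "coeff_even n k = (\<Sum>i=0..k. 2 * int (2 * n choose (2 * i)) * int (multichoose n (k - i)))"
proof -
  have "coeff_even n k = 2 * (\<Sum>i=0..<Suc n. binom (int (2 * n)) (int (2 * i))
      * binom (int k - int i + int n - 1) (int k - int i))"
    by (simp add: coeff_even_def atLeastLessThanSuc_atLeastAtMost)
  also have "\<dots> = 2 * (\<Sum>i=0..k. int (2 * n choose (2 * i)) * int (multichoose n (k - i)))"
    by (subst sum_choose_multichoose) auto
  finally show ?thesis by (simp add: sum_distrib_left mult.assoc)
qed

lemma coeff_odd_eq:
  "coeff_odd n k = (\<Sum>i=0..k. - 2 * int (2 * n choose (2 * i + 1)) * int (multichoose n (k - i)))"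
proof -
  have "coeff_odd n k = - 2 * (\<Sum>i=0..<n. binom (int (2 * n)) (int (2 * i + 1))
      * binom (int k - int i + int n - 1) (int k - int i))"
    by (simp add: coeff_odd_def algebra_simps)
  also have "\<dots> = - 2 * (\<Sum>i=0..k. int (2 * n choose (2 * i + 1)) * int (multichoose n (k - i)))"
    by (subst sum_choose_multichoose) auto
  finally show ?thesis by (simp add: sum_distrib_left mult.assoc)
qed

text \<open>Adding the two binomial expansions doubles the even terms and cancels the odd ones; the
  coefficients are then the Cauchy product with the expansion of \<open>(1 - u^2)^(-n)\<close>.\<close>

lemma plus_series_eq:
  "plus_series n = ((1 - fps_X) ^ (2 * n) + (1 + fps_X) ^ (2 * n)) * inverse (1 - fps_X ^ 2 :: 'k::field fps) ^ n"
  (is "_ = ?N * ?D")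
proof (rule fps_ext)
  fix m
  define f :: "nat \<Rightarrow> 'k" where "f i = ?N $ i * ?D $ (m - i)" for i
  have N: "?N $ i = (if even i then 2 * of_nat (2 * n choose i) else 0)" for i
    by (auto simp: one_plus_X_power_nth one_minus_X_power_nth)
  have "(?N * ?D) $ m = (\<Sum>i=0..m. f i)"
    by (simp add: fps_mult_nth f_def)
  also have "\<dots> = plus_series n $ m"
  proof (cases "even m")
    case True
    then obtain k where k: "m = 2 * k" by blast
    have "(\<Sum>i=0..m. f i) = (\<Sum>i=0..k. f (2 * i))"
      unfolding k by (rule sum_upto_even) (use N in \<open>simp add: f_def del: fps_add_nth\<close>)
    also have "\<dots> = of_int (\<Sum>i=0..k. 2 * int (2 * n choose (2 * i)) * int (multichoose n (k - i)))"
      unfolding of_int_sum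
      by (intro sum.cong refl) (use N in \<open>auto simp: f_def k inverse_one_minus_X_squared_power
        diff_mult_distrib2[symmetric] simp del: fps_add_nth\<close>)
    finally show ?thesis
      by (simp add: plus_series_def k coeff_even_eq)
  next
    case False
    have "f i = 0" if "i \<le> m" for i
      using False that N by (simp add: f_def inverse_one_minus_X_squared_power del: fps_add_nth)
    thus ?thesis using False by (simp add: plus_series_def)
  qed
  finally show "plus_series n $ m = (?N * ?D) $ m" by simp
qed

lemma minus_series_eq:
  "minus_series n = ((1 - fps_X) ^ (2 * n) - (1 + fps_X) ^ (2 * n)) * inverse (1 - fps_X ^ 2 :: 'k::field fps) ^ n"
  (is "_ = ?N * ?D")
proof (rule fps_ext)
  fix m
  define f :: "nat \<Rightarrow> 'k" where "f i = ?N $ i * ?D $ (m - i)" for i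
  have N: "?N $ i = (if odd i then - 2 * of_nat (2 * n choose i) else 0)" for i
    by (auto simp: one_plus_X_power_nth one_minus_X_power_nth)
  have "(?N * ?D) $ m = (\<Sum>i=0..m. f i)"
    by (simp add: fps_mult_nth f_def)
  also have "\<dots> = minus_series n $ m"
  proof (cases "odd m")
    case True
    then obtain k where k: "m = 2 * k + 1" by (rule oddE)
    have "(\<Sum>i=0..m. f i) = (\<Sum>i=0..k. f (2 * i + 1))"
      unfolding k by (rule sum_upto_odd) (use N in \<open>simp add: f_def del: fps_sub_nth\<close>)
    also have "\<dots> = of_int (\<Sum>i=0..k. - 2 * int (2 * n choose (2 * i + 1)) * int (multichoose n (k - i)))"
      unfolding of_int_sum
      by (intro sum.cong refl) (use N in \<open>auto simp: f_def k inverse_one_minus_X_squared_power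
        diff_mult_distrib2[symmetric] simp del: fps_sub_nth\<close>)
    finally show ?thesis
      by (simp add: minus_series_def k coeff_odd_eq)
  next
    case False
    have "f i = 0" if "i \<le> m" for i
      using False that N by (simp add: f_def inverse_one_minus_X_squared_power del: fps_sub_nth)
    thus ?thesis using False by (simp add: minus_series_def)
  qed
  finally show "minus_series n $ m = (?N * ?D) $ m" by simp
qed

text \<open>The combinatorially defined series are the images of \<open>t^n \<plusminus> t^(-n)\<close> under the substitution
  \<open>t = s (1 - u) / (1 + u)\<close>, up to the sign \<open>s^n\<close>.\<close>

lemma cayley_power_plus_minus:
  "cayley_power s (int n) + cayley_power s (- int n) = fps_const (s ^ n) * plus_series n"
  "cayley_power s (int n) - cayley_power s (- int n) = fps_const (s ^ n) * minus_series n"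
  by (simp_all add: cayley_power_of_nat plus_series_eq minus_series_eq algebra_simps)

text \<open>The vector field \<open>- (1 - u^2) / 2 d/du\<close> is \<open>t d/dt\<close> in the coordinate \<open>u\<close>, so \<open>t^n\<close> is an eigenvector
  with eigenvalue \<open>n\<close>. This is the source of all linear independence used below.\<close>

lemma cayley_power_ode:
  fixes s :: "'k::field"
  assumes s: "s * s = 1"
  shows "(1 - fps_X ^ 2) * fps_deriv (cayley_power s n) = fps_const (- 2 * of_int n) * cayley_power s n"
proof -
  \<comment> \<open>The exponents for which the equation holds are closed under addition, by the product rule.\<close>
  have add: "(1 - fps_X ^ 2) * fps_deriv (cayley_power s n) = fps_const (- 2 * of_int n) * cayley_power s n" if
      a: "(1 - fps_X ^ 2) * fps_deriv (cayley_power s a) = fps_const (- 2 * of_int a) * cayley_power s a" and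
      b: "(1 - fps_X ^ 2) * fps_deriv (cayley_power s b) = fps_const (- 2 * of_int b) * cayley_power s b"
      and n: "n = a + b" for a b n
  proof -
    have "(1 - fps_X ^ 2) * fps_deriv (cayley_power s n)
       = ((1 - fps_X ^ 2) * fps_deriv (cayley_power s a)) * cayley_power s b
         + cayley_power s a * ((1 - fps_X ^ 2) * fps_deriv (cayley_power s b))"
      by (simp add: n cayley_power_add[OF s] algebra_simps)
    also have "\<dots> = (fps_const (- 2 * of_int a) + fps_const (- 2 * of_int b))
         * (cayley_power s a * cayley_power s b)"
      unfolding a b by (simp only: algebra_simps)
    also have "fps_const (- 2 * of_int a :: 'k) + fps_const (- 2 * of_int b) = fps_const (- 2 * of_int n)"
      by (simp add: n algebra_simps)
    finally show ?thesis
      by (simp only: cayley_power_add[OF s, of a b, folded n])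
  qed
  have one: "(1 - fps_X ^ 2) * fps_deriv (cayley_power s 1) = fps_const (- 2 * of_int 1) * cayley_power s 1"
  proof -
    define q where "q = (1 - fps_X) * inverse (1 + fps_X :: 'k fps)"
    have "(1 + fps_X) * q = (1 - fps_X) * ((1 + fps_X) * inverse (1 + fps_X))"
      unfolding q_def by (simp only: ac_simps)
    hence q: "(1 + fps_X) * q = 1 - fps_X"
      by (simp add: inverse_one_plus_minus_X)
    have "fps_deriv ((1 + fps_X) * q) = -1"
      unfolding q by simp
    hence dq: "(1 + fps_X) * fps_deriv q = - 1 - q"
      by (simp add: algebra_simps)
    have "(1 - fps_X ^ 2) * fps_deriv q = (1 - fps_X) * ((1 + fps_X) * fps_deriv q)"
      by (simp add: algebra_simps power2_eq_square)
    also have "\<dots> = - (1 - fps_X) - (1 - fps_X) * q"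
      unfolding dq by (simp add: algebra_simps)
    also have "\<dots> = - ((1 + fps_X) * q) - (1 - fps_X) * q"
      unfolding q by simp
    also have "\<dots> = fps_const (- 2) * q"
      by (simp add: algebra_simps fps_const_neg[symmetric] fps_numeral_fps_const[symmetric])
    finally have "(1 - fps_X ^ 2) * fps_deriv q = fps_const (- 2) * q" .
    hence "fps_const s * ((1 - fps_X ^ 2) * fps_deriv q) = fps_const s * (fps_const (- 2) * q)"
      by (simp only:)
    thus ?thesis
      by (simp add: cayley_power_def q_def[symmetric] mult.left_commute)
  qed
  have minus_one: "(1 - fps_X ^ 2) * fps_deriv (cayley_power s (- 1))
      = fps_const (- 2 * of_int (- 1)) * cayley_power s (- 1)"
  proof -
    have inv: "cayley_power s 1 * cayley_power s (- 1) = 1"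
      using cayley_power_add[OF s, of 1 "- 1"] by simp
    hence "fps_deriv (cayley_power s 1 * cayley_power s (- 1)) = 0"
      by simp
    hence "cayley_power s 1 * fps_deriv (cayley_power s (- 1))
        = - (fps_deriv (cayley_power s 1) * cayley_power s (- 1))"
      by (simp add: eq_neg_iff_add_eq_0 add.commute)
    hence "cayley_power s (- 1) * (1 - fps_X ^ 2) * (cayley_power s 1 * fps_deriv (cayley_power s (- 1)))
        = cayley_power s (- 1) * (1 - fps_X ^ 2) * - (fps_deriv (cayley_power s 1) * cayley_power s (- 1))"
      by (simp only:)
    hence "(cayley_power s 1 * cayley_power s (- 1)) * ((1 - fps_X ^ 2) * fps_deriv (cayley_power s (- 1)))
        = - (((1 - fps_X ^ 2) * fps_deriv (cayley_power s 1)) * cayley_power s (- 1) * cayley_power s (- 1))"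
      by (simp only: mult_minus_right ac_simps)
    also have "\<dots> = - (fps_const (- 2) * (cayley_power s 1 * cayley_power s (- 1)) * cayley_power s (- 1))"
      unfolding one by (simp add: mult.assoc)
    finally show ?thesis
      by (simp only: inv) (simp flip: fps_const_neg)
  qed
  show ?thesis
  proof (induction n rule: int_induct[where k = 0])
    case (step1 i)
    show ?case using add[OF step1.IH one] by blast
  next
    case (step2 i)
    show ?case using add[OF step2.IH minus_one] by simp
  qed simp
qed

text \<open>The differential equation, read off coefficientwise. At \<open>k = 0\<close> the truncated index \<open>k - 1\<close> comes
  with the coefficient 0.\<close>

lemma cayley_power_recurrence:
  fixes s :: "'k::field"
  assumes s: "s * s = 1"
  shows "of_nat (Suc k) * cayley_power s n $ Suc k - of_nat (k - 1) * cayley_power s n $ (k - 1)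
           = - 2 * of_int n * cayley_power s n $ k"
proof -
  have "((1 - fps_X ^ 2) * fps_deriv (cayley_power s n)) $ k
      = of_nat (Suc k) * cayley_power s n $ Suc k - of_nat (k - 1) * cayley_power s n $ (k - 1)"
  proof (cases "k < 2")
    case True
    hence "k = 0 \<or> k = 1" by linarith
    thus ?thesis by (auto simp: left_diff_distrib fps_X_power_mult_nth)
  next
    case False
    then obtain j where "k = Suc (Suc j)"
      by (metis add_2_eq_Suc le_add_diff_inverse not_less)
    thus ?thesis by (simp add: left_diff_distrib fps_X_power_mult_nth)
  qed
  thus ?thesis
    unfolding cayley_power_ode[OF s] by simp
qed

lemma cayley_power_nth_0:
  fixes s :: "'k::field"
  assumes s: "s * s = 1"
  shows "cayley_power s (- n) $ 0 = cayley_power s n $ 0" "cayley_power s n $ 0 \<noteq> 0"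
proof -
  show "cayley_power s (- n) $ 0 = cayley_power s n $ 0"
    by (auto simp: cayley_power_def fps_nth_power_0 fps_mult_nth_0)
  have "s \<noteq> 0" using s by auto
  thus "cayley_power s n $ 0 \<noteq> 0"
    by (auto simp: cayley_power_def fps_nth_power_0)
qed

text \<open>The substitution \<open>u \<mapsto> - u\<close> exchanges \<open>t\<close> and \<open>1 / t\<close>. Both sides satisfy the same recurrence with the
  same initial value, and the recurrence has a unique solution in characteristic 0.\<close>

lemma cayley_power_uminus_nth:
  fixes s :: "'k::field_char_0"
  assumes s: "s * s = 1"
  shows "cayley_power s (- n) $ k = (- 1) ^ k * cayley_power s n $ k"
proof (induction k rule: less_induct)
  case (less k)
  show ?case
  proof (cases k)
    case 0
    thus ?thesis using cayley_power_nth_0[OF s] by simp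
  next
    case (Suc j)
    \<comment> \<open>For \<open>j = 0\<close> the truncated index \<open>j - 1\<close> is harmless, since its coefficient vanishes.\<close>
    have pred: "of_nat (j - 1) * cayley_power s (- n) $ (j - 1)
        = - ((- 1) ^ j * (of_nat (j - 1) * cayley_power s n $ (j - 1)))"
      using less[of "j - 1"] by (cases j) (auto simp: Suc)
    have "of_nat (Suc j) * cayley_power s (- n) $ Suc j
        = 2 * of_int n * cayley_power s (- n) $ j + of_nat (j - 1) * cayley_power s (- n) $ (j - 1)"
      using cayley_power_recurrence[OF s, of j "- n"] by (simp add: algebra_simps)
    also have "\<dots> = - ((- 1) ^ j * (- 2 * of_int n * cayley_power s n $ j
        + of_nat (j - 1) * cayley_power s n $ (j - 1)))"
      unfolding pred using less[of j] by (simp add: Suc algebra_simps)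
    also have "- 2 * of_int n * cayley_power s n $ j + of_nat (j - 1) * cayley_power s n $ (j - 1)
        = of_nat (Suc j) * cayley_power s n $ Suc j"
      using cayley_power_recurrence[OF s, of j n] by (simp add: algebra_simps)
    finally have "of_nat (Suc j) * cayley_power s (- n) $ Suc j
        = of_nat (Suc j) * ((- 1) ^ Suc j * cayley_power s n $ Suc j)"
      by (simp add: algebra_simps)
    thus ?thesis
      unfolding Suc by (simp only: mult_cancel_left of_nat_eq_0_iff) simp
  qed
qed

text \<open>Two consecutive zeros propagate down to the coefficient of index 0, which is \<open>\<plusminus>1\<close>. For \<open>n = 0\<close>
  this breaks down at index 1, as the constant series 1 shows.\<close>

lemma cayley_power_consecutive_zeros:
  fixes s :: "'k::field_char_0"
  assumes s: "s * s = 1" and "n \<noteq> 0"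
    and "cayley_power s n $ k = 0" "cayley_power s n $ Suc k = 0"
  shows False
  using assms(3,4)
proof (induction k)
  case 0
  thus ?case using cayley_power_nth_0[OF s] by simp
next
  case (Suc k)
  have "of_nat k * cayley_power s n $ k = 0"
    using cayley_power_recurrence[OF s, of "Suc k" n] Suc.prems by simp
  hence "cayley_power s n $ k = 0"
    using cayley_power_recurrence[OF s, of 0 n] Suc.prems \<open>n \<noteq> 0\<close> by (cases "k = 0") auto
  thus ?case using Suc by blast
qed

section \<open>Subalgebras and images of Lie algebras\<close>

lemma lie_algebra_restrict:
  assumes "lie_algebra L" and "S \<subseteq> lcarrier L" and "lzero L \<in> S"
    and add: "\<And>x y. x \<in> S \<Longrightarrow> y \<in> S \<Longrightarrow> ladd L x y \<in> S"
    and scale: "\<And>c x. x \<in> S \<Longrightarrow> lscale L c x \<in> S"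
    and bracket: "\<And>x y. x \<in> S \<Longrightarrow> y \<in> S \<Longrightarrow> lbracket L x y \<in> S"
  shows "lie_algebra (lie_restrict L S)"
proof -
  interpret lie_algebra L by fact
  have inverse: "\<exists>y \<in> S. ladd L x y = lzero L" if "x \<in> S" for x
  proof
    have x: "x \<in> lcarrier L" using that assms(2) by blast
    \<comment> \<open>The inverse of \<open>x\<close> is \<open>-1\<close> times \<open>x\<close>; for this, \<open>0\<close> times \<open>x\<close> must be the zero vector, which
      follows by cancellation from its being idempotent under addition.\<close>
    define z where "z = lscale L 0 x"
    have z: "z \<in> lcarrier L" using x scale_closed by (simp add: z_def)
    have "ladd L z z = z"
      using add_scale[OF x, of 0 0] by (simp add: z_def)
    moreover obtain w where w: "w \<in> lcarrier L" "ladd L z w = lzero L"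
      using add_inverse[OF z] by blast
    ultimately have "z = lzero L"
      using add_assoc[OF z z w(1)] add_commute[OF z zero_closed] add_zero[OF z] by simp
    thus "ladd L x (lscale L (- 1) x) = lzero L"
      using add_scale[OF x, of 1 "- 1"] scale_one[OF x] by (simp add: z_def)
    show "lscale L (- 1) x \<in> S" using that scale by blast
  qed
  have sub: "x \<in> lcarrier L" if "x \<in> S" for x
    using that assms(2) by blast
  show ?thesis
    by standard
       (simp_all add: lie_restrict_def assms(3) add scale bracket inverse sub add_zero scale_add add_scale
          scale_scale scale_one bracket_add_left bracket_add_right bracket_scale_left bracket_scale_right
          bracket_alternating jacobi add_assoc, (metis add_commute sub)?)
qed

lemma lie_algebra_image:
  assumes "lie_algebra L" and lin: "linear_between \<phi> L M"
    and br: "\<And>x y. x \<in> lcarrier L \<Longrightarrow> y \<in> lcarrier L \<Longrightarrow> \<phi> (lbracket L x y) = lbracket M (\<phi> x) (\<phi> y)"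
    and surj: "lcarrier M = \<phi> ` lcarrier L" and zero: "\<phi> (lzero L) = lzero M"
  shows "lie_algebra M"
proof -
  interpret lie_algebra L by fact
  have add: "ladd M (\<phi> x) (\<phi> y) = \<phi> (ladd L x y)" if "x \<in> lcarrier L" "y \<in> lcarrier L" for x y
    using lin that by (simp add: linear_between_def)
  have scale: "lscale M c (\<phi> x) = \<phi> (lscale L c x)" if "x \<in> lcarrier L" for c x
    using lin that by (simp add: linear_between_def)
  note hom = add scale br[symmetric] zero[symmetric]
  show ?thesis
  proof
    fix x assume "x \<in> lcarrier M"
    then obtain a where a: "a \<in> lcarrier L" "x = \<phi> a" by (auto simp: surj)
    show "\<exists>y \<in> lcarrier M. ladd M x y = lzero M"
      using add_inverse[OF a(1)] a by (metis add surj imageI zero)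
  next
    fix x y assume "x \<in> lcarrier M" "y \<in> lcarrier M"
    then obtain a b where "a \<in> lcarrier L" "x = \<phi> a" "b \<in> lcarrier L" "y = \<phi> b" by (auto simp: surj)
    thus "ladd M x y = ladd M y x" by (simp add: add add_commute)
  qed (auto simp: surj hom zero_closed add_closed scale_closed bracket_closed add_zero scale_add add_scale
          scale_scale scale_one bracket_add_left bracket_add_right bracket_scale_left bracket_scale_right
          bracket_alternating jacobi add_assoc)
qed

section \<open>Series with coefficients in a Lie algebra\<close>

lemma sum_apply: "(\<Sum>i\<in>I. F i) n = (\<Sum>i\<in>I. F i n)"
  by (induction I rule: infinite_finite_induct) simp_all

locale lie_type =
  fixes sc :: "'k::field_char_0 \<Rightarrow> 'a::ab_group_add \<Rightarrow> 'a" and br :: "'a \<Rightarrow> 'a \<Rightarrow> 'a"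
  assumes lie: "lie_algebra (lie_of sc br)"
begin

sublocale vector_space sc
  using lie_algebra.scale_add[OF lie] lie_algebra.add_scale[OF lie] lie_algebra.scale_scale[OF lie]
    lie_algebra.scale_one[OF lie]
  by unfold_locales (simp_all add: lie_of_def)

lemma br_add: "br (x + y) z = br x z + br y z" "br x (y + z) = br x y + br x z"
  using lie_algebra.bracket_add_left[OF lie] lie_algebra.bracket_add_right[OF lie]
  by (simp_all add: lie_of_def)

lemma br_scale: "br (sc c x) y = sc c (br x y)" "br x (sc c y) = sc c (br x y)"
  using lie_algebra.bracket_scale_left[OF lie] lie_algebra.bracket_scale_right[OF lie]
  by (simp_all add: lie_of_def)

lemma br_zero [simp]: "br 0 x = 0" "br x 0 = 0"
  using br_add[of 0 0] br_add(2)[of x 0 0] by simp_all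

lemma br_minus: "br (- x) y = - br x y" "br x (- y) = - br x y"
  using br_add(1)[of x "- x" y] br_add(2)[of x y "- y"] by (simp_all add: eq_neg_iff_add_eq_0 add.commute)

lemma br_sum: "br (\<Sum>i\<in>I. F i) y = (\<Sum>i\<in>I. br (F i) y)" "br x (\<Sum>i\<in>I. F i) = (\<Sum>i\<in>I. br x (F i))"
  by (induction I rule: infinite_finite_induct) (simp_all add: br_add)

lemma br_self: "br x x = 0"
  using lie_algebra.bracket_alternating[OF lie] by (simp add: lie_of_def)

lemma br_anticommute: "br x y = - br y x"
  using br_self[of "x + y"] unfolding br_add by (simp add: br_self eq_neg_iff_add_eq_0 add.commute)

lemma br_jacobi: "br x (br y z) + (br y (br z x) + br z (br x y)) = 0"
  using lie_algebra.jacobi[OF lie] by (simp add: lie_of_def)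

lemma series_scale_vector_space: "vector_space (series_scale sc)"
  by unfold_locales (auto simp: series_scale_def fun_eq_iff scale_right_distrib scale_left_distrib)

text \<open>This form is symmetric enough for the Jacobi identity to reduce, after cyclic relabelling, to the
  Jacobi identity of the coefficients.\<close>

lemma series_bracket_assoc:
  "series_bracket br F (series_bracket br G H) n
     = (\<Sum>(i, j, k) | i + j + k = n. br (F i) (br (G j) (H k)))"
proof -
  have "series_bracket br F (series_bracket br G H) n
      = (\<Sum>(i, j) \<in> (SIGMA i:{..n}. {..n - i}). br (F i) (br (G j) (H (n - i - j))))"
    by (simp add: series_bracket_def br_sum sum.Sigma)
  also have "\<dots> = (\<Sum>(i, j, k) | i + j + k = n. br (F i) (br (G j) (H k)))"
    by (rule sum.reindex_bij_witness[where i = "\<lambda>(i, j, k). (i, j)" and j = "\<lambda>(i, j). (i, j, n - i - j)"])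
       auto
  finally show ?thesis .
qed

lemma series_bracket_anticommute: "series_bracket br F G = - series_bracket br G F"
proof
  fix n
  have "series_bracket br F G n = (\<Sum>i\<le>n. - br (G (n - i)) (F i))"
    unfolding series_bracket_def by (intro sum.cong refl br_anticommute)
  also have "\<dots> = - series_bracket br G F n"
    unfolding series_bracket_def sum_negf
    by (rule arg_cong[of _ _ uminus], rule sum.reindex_bij_witness[where i = "\<lambda>i. n - i" and j = "\<lambda>i. n - i"]) auto
  finally show "series_bracket br F G n = (- series_bracket br G F) n" by simp
qed

lemma eq_uminus_self:
  fixes x :: 'a
  assumes "x = - x"
  shows "x = 0"
proof -
  have "sc 2 x = sc 1 x + sc 1 x"
    using scale_left_distrib[of 1 1 x] by simp
  also have "\<dots> = 0" using assms by (simp add: eq_neg_iff_add_eq_0)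
  finally show ?thesis by simp
qed

lemma lie_algebra_series: "lie_algebra (lie_of (series_scale sc) (series_bracket br))"
proof -
  interpret S: vector_space "series_scale sc" by (rule series_scale_vector_space)
  have "series_bracket br F F n = 0" for F n
    using series_bracket_anticommute[of F F] eq_uminus_self[of "series_bracket br F F n"]
    by (metis fun_Compl_def)
  hence self: "series_bracket br F F = 0" for F
    by (simp add: fun_eq_iff)
  have "series_bracket br F (series_bracket br G H) n + (series_bracket br G (series_bracket br H F) n
        + series_bracket br H (series_bracket br F G) n) = 0" for F G H n
  proof -
    have "series_bracket br G (series_bracket br H F) n
        = (\<Sum>(i, j, k) | i + j + k = n. br (G j) (br (H k) (F i)))"
      unfolding series_bracket_assoc
      by (rule sum.reindex_bij_witness[where i = "\<lambda>(i, j, k). (j, k, i)" and j = "\<lambda>(j, k, i). (i, j, k)"]) auto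
    moreover have "series_bracket br H (series_bracket br F G) n
        = (\<Sum>(i, j, k) | i + j + k = n. br (H k) (br (F i) (G j)))"
      unfolding series_bracket_assoc
      by (rule sum.reindex_bij_witness[where i = "\<lambda>(i, j, k). (k, i, j)" and j = "\<lambda>(k, i, j). (i, j, k)"]) auto
    ultimately show ?thesis
      unfolding series_bracket_assoc by (simp add: sum.distrib[symmetric] case_prod_unfold br_jacobi)
  qed
  hence jacobi: "series_bracket br F (series_bracket br G H) + (series_bracket br G (series_bracket br H F)
        + series_bracket br H (series_bracket br F G)) = 0" for F G H
    by (simp add: fun_eq_iff)
  show ?thesis
  proof
    fix x :: "nat \<Rightarrow> 'a"
    show "\<exists>y \<in> lcarrier (lie_of (series_scale sc) (series_bracket br)).
        ladd (lie_of (series_scale sc) (series_bracket br)) x y = lzero (lie_of (series_scale sc) (series_bracket br))"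
      by (rule bexI[of _ "- x"]) (simp_all add: lie_of_def)
  qed (simp_all add: lie_of_def S.scale_right_distrib S.scale_left_distrib self jacobi algebra_simps,
       simp_all add: series_bracket_def series_scale_def fun_eq_iff br_add br_scale sum.distrib scale_sum_right)
qed

text \<open>For a space of finite dimension, the span of the pure tensors is everything that coordinates can
  see: a sequence in \<open>V\<close> is the sum, over a basis of \<open>V\<close>, of its coordinate series times the basis
  vector. Prescribing zeros of the sequence prescribes zeros of all coordinate series.\<close>

lemma tensor_space_eq:
  assumes fin: "finite b" "span b = UNIV" and V: "subspace V"
  shows "tensor_space sc {P. \<forall>n \<in> Z. fps_nth P n = 0} V = {G. (\<forall>n. G n \<in> V) \<and> (\<forall>n \<in> Z. G n = 0)}"
proof -
  interpret S: vector_space "series_scale sc" by (rule series_scale_vector_space)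
  let ?T = "{series_tensor sc P x | P x. P \<in> {P. \<forall>n \<in> Z. fps_nth P n = 0} \<and> x \<in> V}"
  have "S.span ?T \<subseteq> {G. (\<forall>n. G n \<in> V) \<and> (\<forall>n \<in> Z. G n = 0)}"
  proof (rule S.span_minimal)
    show "S.subspace {G. (\<forall>n. G n \<in> V) \<and> (\<forall>n \<in> Z. G n = 0)}"
      using V by (auto simp: S.subspace_def subspace_def series_scale_def)
  qed (use V in \<open>auto simp: series_tensor_def subspace_scale\<close>)
  moreover have "G \<in> S.span ?T" if G: "\<forall>n. G n \<in> V" "\<forall>n \<in> Z. G n = 0" for G
  proof -
    obtain c where c: "c \<subseteq> V" "independent c" "V \<subseteq> span c"
      using maximal_independent_subset[of V] by blast
    have finc: "finite c"
      using independent_span_bound[OF fin(1) c(2)] fin(2) by simp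
    \<comment> \<open>The coordinates of \<open>G\<close> with respect to a finite basis of \<open>V\<close> are power series that vanish on \<open>Z\<close>.\<close>
    define P where "P v = Abs_fps (\<lambda>n. representation c (G n) v)" for v
    have "G = (\<Sum>v\<in>c. series_tensor sc (P v) v)"
    proof
      fix n
      have "G n = (\<Sum>v\<in>c. sc (representation c (G n) v) v)"
        using c G finc by (intro sum_representation_eq[symmetric]) auto
      also have "\<dots> = (\<Sum>v\<in>c. series_tensor sc (P v) v) n"
        by (simp add: sum_apply series_tensor_def P_def)
      finally show "G n = (\<Sum>v\<in>c. series_tensor sc (P v) v) n" .
    qed
    moreover have "series_tensor sc (P v) v \<in> ?T" if "v \<in> c" for v
      using that c(1) G(2) by (intro CollectI exI[of _ "P v"] exI[of _ v]) (auto simp: P_def representation_zero)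
    ultimately show ?thesis
      by (simp only: S.span_sum S.span_base)
  qed
  ultimately show ?thesis
    unfolding tensor_space_def by (intro equalityI subsetI) auto
qed

end

section \<open>Truncation of series\<close>

locale finite_dim_lie_type = lie_type sc br
  for sc :: "'k::field_char_0 \<Rightarrow> 'a::ab_group_add \<Rightarrow> 'a" and br :: "'a \<Rightarrow> 'a \<Rightarrow> 'a" +
  assumes finite_span: "\<exists>b. finite b \<and> span b = UNIV"
begin

lemma tensor_space_vanishing:
  assumes "subspace V"
  shows "tensor_space sc {P. \<forall>n \<in> Z. fps_nth P n = 0} V = {G. (\<forall>n. G n \<in> V) \<and> (\<forall>n \<in> Z. G n = 0)}"
  using finite_span tensor_space_eq[OF _ _ assms] by blast

lemma series_algebra_eq: "series_algebra sc br = lie_of (series_scale sc) (series_bracket br)"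
proof -
  have "tensor_space sc UNIV UNIV = UNIV"
    using tensor_space_vanishing[of UNIV "{}"] by simp
  thus ?thesis
    by (simp add: series_algebra_def lie_restrict_def lie_of_def)
qed

lemma tensor_space_trunc_ideal: "tensor_space sc (trunc_ideal N) UNIV = {G. \<forall>n\<le>N. G n = 0}"
proof -
  have "P \<in> trunc_ideal N \<longleftrightarrow> (\<forall>n \<in> {..N}. fps_nth P n = 0)" for P :: "'k fps"
  proof
    assume P: "\<forall>n \<in> {..N}. fps_nth P n = 0"
    have "P = fps_X ^ (N + 1) * fps_shift (N + 1) P"
      using P by (intro fps_ext) (simp add: fps_X_power_mult_nth del: power_Suc)
    thus "P \<in> trunc_ideal N" unfolding trunc_ideal_def by blast
  qed (auto simp: trunc_ideal_def fps_X_power_mult_nth simp del: power_Suc)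
  hence "trunc_ideal N = {P :: 'k fps. \<forall>n \<in> {..N}. fps_nth P n = 0}" by blast
  thus ?thesis
    using tensor_space_vanishing[of UNIV "{..N}"] by auto
qed

lemma trunc_proj_eq: "trunc_proj sc br N G = {H. \<forall>n\<le>N. H n = G n}"
proof -
  have "H \<in> {G + j | j. \<forall>n\<le>N. j n = 0} \<longleftrightarrow> (\<forall>n\<le>N. H n = G n)" for H
  proof
    assume "\<forall>n\<le>N. H n = G n"
    thus "H \<in> {G + j | j. \<forall>n\<le>N. j n = 0}"
      by (intro CollectI exI[of _ "H - G"]) simp
  qed auto
  thus ?thesis
    by (simp add: trunc_proj_def lie_coset_def series_algebra_eq tensor_space_trunc_ideal lie_of_def set_eq_iff)
qed

lemma trunc_proj_eq_iff: "trunc_proj sc br N G = trunc_proj sc br N H \<longleftrightarrow> (\<forall>n\<le>N. G n = H n)"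
  unfolding trunc_proj_eq by (auto simp: set_eq_iff)

text \<open>The operations on cosets are operations on sets of representatives. In each case the inclusion that
  needs a witness is settled by fixing representatives and putting the remainder into the ideal.\<close>

lemma trunc_proj_hom:
  "ladd (trunc_algebra sc br N) (trunc_proj sc br N F) (trunc_proj sc br N G) = trunc_proj sc br N (F + G)"
  "lscale (trunc_algebra sc br N) c (trunc_proj sc br N F) = trunc_proj sc br N (series_scale sc c F)"
  "lbracket (trunc_algebra sc br N) (trunc_proj sc br N F) (trunc_proj sc br N G)
     = trunc_proj sc br N (series_bracket br F G)"
  "lzero (trunc_algebra sc br N) = trunc_proj sc br N 0"
proof -
  note alg = trunc_algebra_def lie_quotient_def series_algebra_eq tensor_space_trunc_ideal
    lie_of_def trunc_proj_eq
  have "H \<in> {x + y | x y. (\<forall>n\<le>N. x n = F n) \<and> (\<forall>n\<le>N. y n = G n)} \<longleftrightarrow> (\<forall>n\<le>N. H n = F n + G n)" for H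
  proof
    assume "\<forall>n\<le>N. H n = F n + G n"
    thus "H \<in> {x + y | x y. (\<forall>n\<le>N. x n = F n) \<and> (\<forall>n\<le>N. y n = G n)}"
      by (intro CollectI exI[of _ F] exI[of _ "H - F"]) simp
  qed auto
  thus "ladd (trunc_algebra sc br N) (trunc_proj sc br N F) (trunc_proj sc br N G) = trunc_proj sc br N (F + G)"
    by (simp add: alg set_eq_iff)
  have "H \<in> {series_scale sc c x + j | x j. (\<forall>n\<le>N. x n = F n) \<and> (\<forall>n\<le>N. j n = 0)}
      \<longleftrightarrow> (\<forall>n\<le>N. H n = sc c (F n))" for H
  proof
    assume "\<forall>n\<le>N. H n = sc c (F n)"
    thus "H \<in> {series_scale sc c x + j | x j. (\<forall>n\<le>N. x n = F n) \<and> (\<forall>n\<le>N. j n = 0)}"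
      by (intro CollectI exI[of _ F] exI[of _ "H - series_scale sc c F"]) (simp add: series_scale_def)
  qed (auto simp: series_scale_def)
  thus "lscale (trunc_algebra sc br N) c (trunc_proj sc br N F) = trunc_proj sc br N (series_scale sc c F)"
    by (simp add: alg set_eq_iff series_scale_def)
  have cong: "series_bracket br F' G' n = series_bracket br F G n"
    if "\<forall>n\<le>N. F' n = F n" "\<forall>n\<le>N. G' n = G n" "n \<le> N" for F' G' n
    using that by (auto simp: series_bracket_def intro!: sum.cong)
  have "H \<in> {series_bracket br x y + j | x y j. (\<forall>n\<le>N. x n = F n) \<and> (\<forall>n\<le>N. y n = G n) \<and> (\<forall>n\<le>N. j n = 0)}
      \<longleftrightarrow> (\<forall>n\<le>N. H n = series_bracket br F G n)" for H
  proof
    assume "\<forall>n\<le>N. H n = series_bracket br F G n"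
    thus "H \<in> {series_bracket br x y + j | x y j. (\<forall>n\<le>N. x n = F n) \<and> (\<forall>n\<le>N. y n = G n) \<and> (\<forall>n\<le>N. j n = 0)}"
      by (intro CollectI exI[of _ F] exI[of _ G] exI[of _ "H - series_bracket br F G"]) simp
  qed (auto intro: cong)
  thus "lbracket (trunc_algebra sc br N) (trunc_proj sc br N F) (trunc_proj sc br N G)
     = trunc_proj sc br N (series_bracket br F G)"
    by (simp add: alg set_eq_iff)
  show "lzero (trunc_algebra sc br N) = trunc_proj sc br N 0"
    by (simp add: alg)
qed

end

section \<open>Series with parity\<close>

locale involutive_lie_type = finite_dim_lie_type sc br
  for sc :: "'k::field_char_0 \<Rightarrow> 'a::ab_group_add \<Rightarrow> 'a" and br :: "'a \<Rightarrow> 'a \<Rightarrow> 'a" +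
  fixes \<omega> :: "'a \<Rightarrow> 'a"
  assumes \<omega>_hom: "lie_hom \<omega> (lie_of sc br) (lie_of sc br)"
    and \<omega>_involution: "\<omega> (\<omega> x) = x"
begin

lemma \<omega>_add: "\<omega> (x + y) = \<omega> x + \<omega> y"
  and \<omega>_scale: "\<omega> (sc c x) = sc c (\<omega> x)"
  and \<omega>_br: "\<omega> (br x y) = br (\<omega> x) (\<omega> y)"
  using \<omega>_hom by (simp_all add: lie_hom_def linear_between_def lie_of_def)

lemma \<omega>_0 [simp]: "\<omega> 0 = 0"
  using \<omega>_add[of 0 0] by simp

lemma \<omega>_minus: "\<omega> (- x) = - \<omega> x"
  using \<omega>_add[of x "- x"] by (simp add: eq_neg_iff_add_eq_0 add.commute)

lemma \<omega>_sum: "\<omega> (\<Sum>i\<in>I. F i) = (\<Sum>i\<in>I. \<omega> (F i))"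
  by (induction I rule: infinite_finite_induct) (simp_all add: \<omega>_add)

text \<open>The direct sum of the even series in the \<open>+1\<close> eigenspace and the odd series in the \<open>-1\<close> eigenspace,
  written as the set of fixed points of applying \<open>\<omega>\<close> and \<open>u \<mapsto> - u\<close>
  simultaneously.\<close>

definition parity_series :: "(nat \<Rightarrow> 'a) set" where
  "parity_series = {G. \<forall>n. \<omega> (G n) = sc ((- 1) ^ n) (G n)}"

lemma parity_series_split:
  "{F + G | F G. F \<in> tensor_space sc even_series (plus_eigenspace \<omega>) \<and>
                 G \<in> tensor_space sc odd_series (minus_eigenspace \<omega>)} = parity_series"
proof -
  have sub: "subspace (plus_eigenspace \<omega>)" "subspace (minus_eigenspace \<omega>)"
    by (auto simp: subspace_def plus_eigenspace_def minus_eigenspace_def \<omega>_add \<omega>_scale)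
  have even: "tensor_space sc even_series (plus_eigenspace \<omega>)
      = {G. (\<forall>n. \<omega> (G n) = G n) \<and> (\<forall>n. odd n \<longrightarrow> G n = 0)}"
    using tensor_space_vanishing[OF sub(1), of "{n. odd n}"]
    by (simp add: even_series_def plus_eigenspace_def)
  have odd: "tensor_space sc odd_series (minus_eigenspace \<omega>)
      = {G. (\<forall>n. \<omega> (G n) = - G n) \<and> (\<forall>n. even n \<longrightarrow> G n = 0)}"
    using tensor_space_vanishing[OF sub(2), of "{n. even n}"]
    by (simp add: odd_series_def minus_eigenspace_def)
  have "\<omega> (F n + G n) = sc ((- 1) ^ n) (F n + G n)"
    if "\<forall>n. \<omega> (F n) = F n" "\<forall>n. odd n \<longrightarrow> F n = 0" "\<forall>n. \<omega> (G n) = - G n" "\<forall>n. even n \<longrightarrow> G n = 0" for F G n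
    using that by (cases "even n") (simp_all add: \<omega>_add)
  moreover have "\<exists>F G. H = F + G \<and> (\<forall>n. \<omega> (F n) = F n) \<and> (\<forall>n. odd n \<longrightarrow> F n = 0) \<and>
      (\<forall>n. \<omega> (G n) = - G n) \<and> (\<forall>n. even n \<longrightarrow> G n = 0)"
    if "\<forall>n. \<omega> (H n) = sc ((- 1) ^ n) (H n)" for H
    using that
    by (intro exI[of _ "\<lambda>n. if even n then H n else 0"] exI[of _ "\<lambda>n. if odd n then H n else 0"])
       (auto simp: fun_eq_iff)
  ultimately show ?thesis
    unfolding even odd parity_series_def by fastforce
qed

lemma N_series_eq: "N_series sc br \<omega> = lie_restrict (lie_of (series_scale sc) (series_bracket br)) parity_series"
  by (simp add: N_series_def parity_series_split series_algebra_eq)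

lemma lie_algebra_N_series: "lie_algebra (N_series sc br \<omega>)"
proof -
  have "series_bracket br F G \<in> parity_series" if "F \<in> parity_series" "G \<in> parity_series" for F G
  proof -
    have "\<omega> (br (F i) (G (n - i))) = sc ((- 1) ^ n) (br (F i) (G (n - i)))" if "i \<le> n" for n i
      using that \<open>F \<in> _\<close> \<open>G \<in> _\<close>
      by (simp add: parity_series_def \<omega>_br br_scale power_add[symmetric])
    thus ?thesis
      by (simp add: parity_series_def series_bracket_def \<omega>_sum scale_sum_right)
  qed
  thus ?thesis
    unfolding N_series_eq
    by (intro lie_algebra_restrict lie_algebra_series)
       (auto simp: parity_series_def lie_of_def series_scale_def \<omega>_add \<omega>_scale scale_right_distrib mult.commute)
qed

lemma N_trunc_carrier: "lcarrier (N_trunc sc br \<omega> N) = trunc_proj sc br N ` parity_series"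
  unfolding parity_series_split[symmetric] N_trunc_def lie_restrict_def
  by (auto simp: trunc_proj_hom image_iff) (metis trunc_proj_hom(1))+

text \<open>The truncated algebra is the image of a Lie algebra under a map that respects all operations, hence
  a Lie algebra.\<close>

lemma trunc_proj_lie_hom: "lie_hom (trunc_proj sc br N) (N_series sc br \<omega>) (N_trunc sc br \<omega> N)"
proof -
  have ops: "ladd (N_trunc sc br \<omega> N) = ladd (trunc_algebra sc br N)"
    "lscale (N_trunc sc br \<omega> N) = lscale (trunc_algebra sc br N)"
    "lbracket (N_trunc sc br \<omega> N) = lbracket (trunc_algebra sc br N)"
    "lzero (N_trunc sc br \<omega> N) = lzero (trunc_algebra sc br N)"
    by (simp_all add: N_trunc_def lie_restrict_def)
  have lin: "linear_between (trunc_proj sc br N) (N_series sc br \<omega>) (N_trunc sc br \<omega> N)"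
    by (simp add: linear_between_def ops trunc_proj_hom N_trunc_carrier) (simp add: N_series_eq lie_restrict_def lie_of_def trunc_proj_hom)
  have br: "trunc_proj sc br N (lbracket (N_series sc br \<omega>) F G)
      = lbracket (N_trunc sc br \<omega> N) (trunc_proj sc br N F) (trunc_proj sc br N G)" for F G
    by (simp add: ops trunc_proj_hom N_series_eq lie_restrict_def lie_of_def)
  have "lie_algebra (N_trunc sc br \<omega> N)"
    by (rule lie_algebra_image[OF lie_algebra_N_series lin])
       (simp_all add: br, simp_all add: ops trunc_proj_hom N_trunc_carrier, simp_all add: N_series_eq lie_restrict_def lie_of_def)
  thus ?thesis
    using lin br lie_algebra_N_series by (simp add: lie_hom_def)
qed

end

section \<open>Evaluation of loops at the Cayley transform\<close>

lemma poly_mapping_eq_sum_single: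
  "F = (\<Sum>n \<in> Poly_Mapping.keys F. Poly_Mapping.single n (Poly_Mapping.lookup F n))"
  by (intro poly_mapping_eqI) (auto simp: lookup_sum lookup_single when_def in_keys_iff)

context lie_type
begin

lemma lookup_loop_scale: "Poly_Mapping.lookup (loop_scale sc c F) n = sc c (Poly_Mapping.lookup F n)"
  by (auto simp: loop_scale_def lookup_sum lookup_single when_def in_keys_iff)

lemma loop_scale_zero [simp]: "loop_scale sc 0 F = 0"
  by (intro poly_mapping_eqI) (simp add: lookup_loop_scale)

lemma lookup_loop_degree:
  "Poly_Mapping.lookup (loop_degree sc F) n = sc (of_int n) (Poly_Mapping.lookup F n)"
  by (auto simp: loop_degree_def lookup_sum lookup_single when_def in_keys_iff)

lemma loop_scale_single: "loop_scale sc c (Poly_Mapping.single n x) = Poly_Mapping.single n (sc c x)"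
  by (intro poly_mapping_eqI) (simp add: lookup_loop_scale lookup_single when_def)

lemma loop_degree_single: "loop_degree sc (Poly_Mapping.single n x) = Poly_Mapping.single n (sc (of_int n) x)"
  by (intro poly_mapping_eqI) (simp add: lookup_loop_degree lookup_single when_def)

text \<open>The substitution \<open>t = s (1 - u) / (1 + u)\<close> on the whole loop algebra. The wanted map on the fixed
  subalgebra is its restriction, and most properties are easier to prove before restricting.\<close>

definition loop_eval :: "'k \<Rightarrow> (int \<Rightarrow>\<^sub>0 'a) \<Rightarrow> nat \<Rightarrow> 'a" where
  "loop_eval s F = (\<lambda>k. \<Sum>n \<in> Poly_Mapping.keys F. sc (cayley_power s n $ k) (Poly_Mapping.lookup F n))"

lemma loop_eval_superset:
  assumes "finite S" "Poly_Mapping.keys F \<subseteq> S"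
  shows "loop_eval s F k = (\<Sum>n\<in>S. sc (cayley_power s n $ k) (Poly_Mapping.lookup F n))"
  unfolding loop_eval_def using assms by (intro sum.mono_neutral_left) (auto simp: in_keys_iff)

lemma loop_eval_add: "loop_eval s (F + G) = loop_eval s F + loop_eval s G"
proof
  fix k
  let ?S = "Poly_Mapping.keys F \<union> Poly_Mapping.keys G"
  have "Poly_Mapping.keys (F + G) \<subseteq> ?S" by (rule keys_add)
  thus "loop_eval s (F + G) k = (loop_eval s F + loop_eval s G) k"
    by (simp add: loop_eval_superset[of ?S] lookup_add scale_right_distrib sum.distrib)
qed

lemma loop_eval_0 [simp]: "loop_eval s 0 = 0"
  by (simp add: loop_eval_def fun_eq_iff)

lemma loop_eval_sum: "loop_eval s (\<Sum>i\<in>I. F i) = (\<Sum>i\<in>I. loop_eval s (F i))"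
  by (induction I rule: infinite_finite_induct) (simp_all add: loop_eval_add)

lemma loop_eval_scale: "loop_eval s (loop_scale sc c F) = series_scale sc c (loop_eval s F)"
proof
  fix k
  have "Poly_Mapping.keys (loop_scale sc c F) \<subseteq> Poly_Mapping.keys F"
    by (auto simp: in_keys_iff lookup_loop_scale)
  thus "loop_eval s (loop_scale sc c F) k = series_scale sc c (loop_eval s F) k"
    by (simp add: loop_eval_superset[of "Poly_Mapping.keys F"] lookup_loop_scale series_scale_def
        scale_sum_right mult.commute)
qed

lemma loop_eval_single: "loop_eval s (Poly_Mapping.single n x) = series_tensor sc (cayley_power s n) x"
  by (rule ext) (simp add: loop_eval_superset[of "{n}"] series_tensor_def)

lemma series_bracket_sum:
  "series_bracket br (\<Sum>i\<in>I. F i) G = (\<Sum>i\<in>I. series_bracket br (F i) G)"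
  "series_bracket br G (\<Sum>i\<in>I. F i) = (\<Sum>i\<in>I. series_bracket br G (F i))"
  by (rule ext, simp add: series_bracket_def sum_apply br_sum, rule sum.swap)+

lemma loop_eval_bracket:
  assumes "s * s = 1"
  shows "loop_eval s (loop_bracket br F G) = series_bracket br (loop_eval s F) (loop_eval s G)"
proof -
  have "loop_eval s (loop_bracket br F G)
      = (\<Sum>m\<in>Poly_Mapping.keys F. \<Sum>n\<in>Poly_Mapping.keys G.
           series_bracket br (loop_eval s (Poly_Mapping.single m (Poly_Mapping.lookup F m)))
                             (loop_eval s (Poly_Mapping.single n (Poly_Mapping.lookup G n))))"
    by (simp add: loop_bracket_def loop_eval_sum loop_eval_single cayley_power_add[OF assms]
        series_bracket_tensor[OF lie])
  also have "\<dots> = series_bracket br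
      (loop_eval s (\<Sum>m\<in>Poly_Mapping.keys F. Poly_Mapping.single m (Poly_Mapping.lookup F m)))
      (loop_eval s (\<Sum>n\<in>Poly_Mapping.keys G. Poly_Mapping.single n (Poly_Mapping.lookup G n)))"
    by (simp only: loop_eval_sum series_bracket_sum) (rule sum.swap)
  finally show ?thesis
    by (simp only: poly_mapping_eq_sum_single[symmetric])
qed

text \<open>The degree operator \<open>t d/dt\<close> becomes a three-term difference operator on the coefficients. It
  therefore preserves vanishing on intervals of indices, up to one index at each end.\<close>

lemma loop_eval_degree:
  assumes "s * s = 1"
  shows "sc (- 2) (loop_eval s (loop_degree sc F) k)
    = sc (of_nat (Suc k)) (loop_eval s F (Suc k)) - sc (of_nat (k - 1)) (loop_eval s F (k - 1))"
proof -
  have "Poly_Mapping.keys (loop_degree sc F) \<subseteq> Poly_Mapping.keys F"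
    by (auto simp: in_keys_iff lookup_loop_degree)
  hence "sc (- 2) (loop_eval s (loop_degree sc F) k)
      = (\<Sum>n\<in>Poly_Mapping.keys F. sc (- 2 * of_int n * cayley_power s n $ k) (Poly_Mapping.lookup F n))"
    by (simp add: loop_eval_superset[of "Poly_Mapping.keys F"] lookup_loop_degree scale_sum_right
        mult_ac scale_minus_left sum_negf)
  also have "\<dots> = sc (of_nat (Suc k)) (loop_eval s F (Suc k)) - sc (of_nat (k - 1)) (loop_eval s F (k - 1))"
    unfolding cayley_power_recurrence[OF assms, symmetric]
    by (simp add: loop_eval_def scale_sum_right scale_left_diff_distrib sum_subtractf del: of_nat_Suc)
  finally show ?thesis .
qed

lemma loop_eval_degree_eq_0:
  assumes "s * s = 1" "loop_eval s F (Suc k) = 0" "k = 0 \<or> loop_eval s F (k - 1) = 0"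
  shows "loop_eval s (loop_degree sc F) k = 0"
  using loop_eval_degree[OF assms(1), of F k] assms(2,3) by auto

text \<open>By induction on the support: \<open>degree - n\<close> removes the term of degree \<open>n\<close>, and a single term
  \<open>t^n \<otimes> x\<close> is excluded because the coefficients of \<open>t^n\<close> have no two consecutive zeros. The length of
  the window depends on the number of terms only and its position is free. Placed at the start, it gives
  injectivity; placed far out, it shows that a sequence with infinitely many nonzero terms and
  unbounded gaps is not the series of a loop.\<close>

lemma loop_eval_gap:
  assumes s: "s * s = 1"
  shows "Poly_Mapping.lookup F 0 = 0 \<Longrightarrow>
    (\<And>k. a \<le> k \<Longrightarrow> k \<le> a + 2 * card (Poly_Mapping.keys F) + 1 \<Longrightarrow> loop_eval s F k = 0) \<Longrightarrow> F = 0"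
proof (induction "card (Poly_Mapping.keys F)" arbitrary: F a rule: less_induct)
  case less
  show ?case
  proof (rule ccontr)
    assume "F \<noteq> 0"
    then obtain n where n: "n \<in> Poly_Mapping.keys F"
      by (metis keys_eq_empty equals0I)
    with less.prems(1) have "n \<noteq> 0" by (auto simp: in_keys_iff)
    \<comment> \<open>The operator \<open>degree - n\<close> removes \<open>n\<close> from the support and shrinks the window by one at each end.\<close>
    define F' where "F' = loop_degree sc F + loop_scale sc (- of_int n) F"
    have look: "Poly_Mapping.lookup F' m = sc (of_int (m - n)) (Poly_Mapping.lookup F m)" for m
      by (simp add: F'_def lookup_add lookup_loop_degree lookup_loop_scale scale_left_diff_distrib)
    have "Poly_Mapping.keys F' \<subseteq> Poly_Mapping.keys F - {n}"
      by (auto simp: in_keys_iff look)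
    hence "card (Poly_Mapping.keys F') \<le> card (Poly_Mapping.keys F - {n})"
      by (intro card_mono) auto
    moreover have pos: "card (Poly_Mapping.keys F) > 0"
      using n by (auto simp: card_gt_0_iff)
    ultimately have card: "card (Poly_Mapping.keys F') < card (Poly_Mapping.keys F)"
      using n by simp
    have "F' = 0"
    proof (rule less.hyps[OF card, of "Suc a"])
      show "Poly_Mapping.lookup F' 0 = 0" using less.prems(1) by (simp add: look)
    next
      fix k assume k: "Suc a \<le> k" "k \<le> Suc a + 2 * card (Poly_Mapping.keys F') + 1"
      have "loop_eval s (loop_degree sc F) k = 0" "loop_eval s F k = 0"
        using k card by (auto intro!: loop_eval_degree_eq_0[OF s] less.prems(2))
      thus "loop_eval s F' k = 0"
        by (simp add: F'_def loop_eval_add loop_eval_scale series_scale_def)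
    qed
    hence zero: "Poly_Mapping.lookup F m = 0" if "m \<noteq> n" for m
      using look[of m] that by simp
    have "F = Poly_Mapping.single n (Poly_Mapping.lookup F n)"
      by (intro poly_mapping_eqI) (auto simp: lookup_single when_def zero)
    hence eval: "loop_eval s F k = sc (cayley_power s n $ k) (Poly_Mapping.lookup F n)" for k
      by (metis loop_eval_single series_tensor_def)
    have "cayley_power s n $ k = 0" if "k = a \<or> k = Suc a" for k
    proof -
      have "loop_eval s F k = 0"
        using that pos by (intro less.prems(2)) auto
      thus ?thesis using n by (simp add: eval in_keys_iff)
    qed
    thus False
      using cayley_power_consecutive_zeros[OF s \<open>n \<noteq> 0\<close>, of a] by simp
  qed
qed

lemma loop_degree_eq_0:
  assumes "loop_degree sc F = 0"
  shows "F = Poly_Mapping.single 0 (Poly_Mapping.lookup F 0)"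
proof (rule poly_mapping_eqI)
  fix m
  have "sc (of_int m) (Poly_Mapping.lookup F m) = 0"
    using lookup_loop_degree[of F m] assms by simp
  thus "Poly_Mapping.lookup F m = Poly_Mapping.lookup (Poly_Mapping.single 0 (Poly_Mapping.lookup F 0)) m"
    by (auto simp: lookup_single when_def)
qed

text \<open>The only loops killed by the degree operator are the constants, and substitution leaves them
  unchanged.\<close>

lemma loop_eval_constant:
  assumes "loop_degree sc F = 0"
  shows "loop_eval s F k = (if k = 0 then Poly_Mapping.lookup F 0 else 0)"
  by (subst loop_degree_eq_0[OF assms]) (simp add: loop_eval_single series_tensor_def)

lemma loop_eval_eq_0:
  assumes s: "s * s = 1" and F: "loop_eval s F = 0"
  shows "F = 0"
proof -
  have deg: "loop_degree sc F = 0"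
    by (rule loop_eval_gap[OF s, of _ 0]) (simp_all add: lookup_loop_degree loop_eval_degree_eq_0[OF s] F)
  have "Poly_Mapping.lookup F 0 = 0"
    using loop_eval_constant[OF deg, of s 0] F by simp
  thus ?thesis
    using loop_degree_eq_0[OF deg] by simp
qed

text \<open>The gaps between powers of 2 grow beyond any window, so such a series would come from a constant
  loop; but its coefficient of index 2 is nonzero.\<close>

lemma loop_eval_not_lacunary:
  assumes s: "s * s = 1" and "x \<noteq> 0"
  shows "loop_eval s F \<noteq> (\<lambda>k. if \<exists>m\<ge>1. k = 2 ^ m then x else 0)"
proof
  assume F: "loop_eval s F = (\<lambda>k. if \<exists>m\<ge>1. k = 2 ^ m then x else 0)"
  define d where "d = card (Poly_Mapping.keys (loop_degree sc F))"
  \<comment> \<open>Any exponent for which the gap after \<open>2 ^ M\<close> contains the window that the gap lemma needs will do.\<close>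
  define M where "M = 2 * d + 5"
  have gap: "loop_eval s F k = 0" if "2 ^ M < k" "k < 2 * 2 ^ M" for k
  proof -
    have "k \<noteq> 2 ^ m" for m
    proof
      assume "k = 2 ^ m"
      hence "2 ^ M < (2 ^ m :: nat)" "2 ^ m < (2 ^ Suc M :: nat)" using that by simp_all
      thus False by (simp only: power_strict_increasing_iff)
    qed
    thus ?thesis by (simp add: F)
  qed
  have M: "2 * d + 5 < 2 ^ M" using less_exp[of M] by (simp only: M_def)
  have deg: "loop_degree sc F = 0"
  proof (rule loop_eval_gap[OF s, of _ "2 ^ M + 2"])
    fix k assume k: "2 ^ M + 2 \<le> k" "k \<le> 2 ^ M + 2 + 2 * card (Poly_Mapping.keys (loop_degree sc F)) + 1"
    hence "2 ^ M < k - 1" "Suc k < 2 * 2 ^ M" using M unfolding d_def[symmetric] by linarith+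
    thus "loop_eval s (loop_degree sc F) k = 0"
      by (intro loop_eval_degree_eq_0[OF s] disjI2 gap) linarith+
  qed (simp add: lookup_loop_degree)
  have "loop_eval s F 2 = x"
    by (auto simp: F intro: exI[of _ 1])
  thus False
    using loop_eval_constant[OF deg, of s 2] \<open>x \<noteq> 0\<close> by simp
qed

text \<open>Take \<open>(t - s)^N \<otimes> x\<close>, up to a scalar: since \<open>t - s = - 2 s u + \<dots>\<close>, its series starts
  in degree \<open>N\<close>.\<close>

lemma loop_eval_leading_term:
  assumes s: "s * s = 1"
  shows "\<exists>F. (\<forall>k<N. loop_eval s F k = 0) \<and> loop_eval s F N = x"
proof -
  define w where "w = cayley_power s 1 + fps_const (- s)"
  define c where "c i = of_nat (N choose i) * (- s) ^ (N - i)" for i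
  have "cayley_power s (int i) = cayley_power s 1 ^ i" for i
    by (simp add: cayley_power_def)
  hence wN: "w ^ N = (\<Sum>i\<le>N. fps_const (c i) * cayley_power s (int i))"
    by (simp add: w_def binomial_ring c_def fps_const_power mult_ac flip: fps_const_mult fps_of_nat)
  have "s \<noteq> 0" using s by auto
  have s0: "cayley_power s 1 $ 0 = s"
    by (simp add: cayley_power_def)
  have w0: "w $ 0 = 0" and w1: "w $ 1 = - 2 * s"
    using cayley_power_recurrence[OF s, of 0 1] by (simp_all add: w_def s0)
  define F where "F = (\<Sum>i\<le>N. Poly_Mapping.single (int i) (sc (c i * inverse ((- 2 * s) ^ N)) x))"
  have "loop_eval s F k = sc (w ^ N $ k) (sc (inverse ((- 2 * s) ^ N)) x)" for k
    by (simp add: F_def loop_eval_sum loop_eval_single sum_apply wN series_tensor_def fps_sum_nth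
        scale_sum_left sum_distrib_left mult_ac)
  moreover have "w ^ N $ k = 0" if "k < N" for k
    using startsby_zero_power_prefix[OF w0] that by blast
  moreover have "w ^ N $ N = (- 2 * s) ^ N"
    using startsby_zero_power_nth_same[OF w0] w1 by simp
  ultimately show ?thesis
    using \<open>s \<noteq> 0\<close> by (intro exI[of _ F]) simp
qed

text \<open>Leading terms of all degrees allow the coefficients to be corrected one after the other.\<close>

lemma loop_eval_dense:
  assumes s: "s * s = 1"
  shows "\<exists>F. \<forall>k<N. loop_eval s F k = G k"
proof (induction N)
  case (Suc N)
  then obtain F where F: "\<forall>k<N. loop_eval s F k = G k" by blast
  obtain H where H: "\<forall>k<N. loop_eval s H k = 0" "loop_eval s H N = G N - loop_eval s F N"
    using loop_eval_leading_term[OF s] by blast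
  show ?case
    using F H by (intro exI[of _ "F + H"]) (auto simp: loop_eval_add less_Suc_eq)
qed simp

end

context involutive_lie_type
begin

text \<open>The involution \<open>t^n \<otimes> x \<mapsto> t^(-n) \<otimes> \<omega> x\<close>. It will turn out to be the restriction of the
  Cartan--Chevalley involution to the loop algebra.\<close>

definition loop_reflect :: "(int \<Rightarrow>\<^sub>0 'a) \<Rightarrow> (int \<Rightarrow>\<^sub>0 'a)" where
  "loop_reflect F = (\<Sum>n \<in> Poly_Mapping.keys F. Poly_Mapping.single (- n) (\<omega> (Poly_Mapping.lookup F n)))"

lemma lookup_loop_reflect: "Poly_Mapping.lookup (loop_reflect F) n = \<omega> (Poly_Mapping.lookup F (- n))"
proof -
  have "Poly_Mapping.lookup (loop_reflect F) n
      = (\<Sum>m\<in>Poly_Mapping.keys F. if m = - n then \<omega> (Poly_Mapping.lookup F m) else 0)"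
    unfolding loop_reflect_def lookup_sum lookup_single when_def by (intro sum.cong) auto
  thus ?thesis
    by (auto simp: in_keys_iff)
qed

lemma loop_reflect_add: "loop_reflect (F + G) = loop_reflect F + loop_reflect G"
  by (intro poly_mapping_eqI) (simp add: lookup_loop_reflect lookup_add \<omega>_add)

lemma loop_reflect_scale: "loop_reflect (loop_scale sc c F) = loop_scale sc c (loop_reflect F)"
  by (intro poly_mapping_eqI) (simp add: lookup_loop_reflect lookup_loop_scale \<omega>_scale)

text \<open>Evaluation intertwines the reflection of loops with the combination of \<open>\<omega>\<close> and \<open>u \<mapsto> - u\<close>. So
  fixed loops have series with parity.\<close>

lemma loop_eval_reflect:
  assumes "s * s = 1"
  shows "loop_eval s (loop_reflect F) k = sc ((- 1) ^ k) (\<omega> (loop_eval s F k))"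
proof -
  have "loop_eval s (loop_reflect F) k
      = (\<Sum>n\<in>Poly_Mapping.keys F. sc (cayley_power s (- n) $ k) (\<omega> (Poly_Mapping.lookup F n)))"
    by (simp add: loop_reflect_def loop_eval_sum loop_eval_single sum_apply series_tensor_def)
  thus ?thesis
    by (simp add: cayley_power_uminus_nth[OF assms] loop_eval_def \<omega>_sum \<omega>_scale scale_sum_right)
qed

lemma loop_eval_parity:
  assumes s: "s * s = 1" and F: "loop_reflect F = F"
  shows "loop_eval s F \<in> parity_series"
proof -
  have "loop_eval s F k = sc ((- 1) ^ k) (\<omega> (loop_eval s F k))" for k
    using loop_eval_reflect[OF s, of F k] F by simp
  hence "sc ((- 1) ^ k) (loop_eval s F k) = sc ((- 1) ^ k * (- 1) ^ k) (\<omega> (loop_eval s F k))" for k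
    by (metis scale_scale)
  thus ?thesis
    by (simp add: parity_series_def flip: power_mult_distrib)
qed

lemma loop_reflect_dense:
  assumes s: "s * s = 1" and G: "G \<in> parity_series"
  shows "\<exists>F. loop_reflect F = F \<and> (\<forall>k\<le>N. loop_eval s F k = G k)"
proof -
  obtain F where F: "\<forall>k<Suc N. loop_eval s F k = G k"
    using loop_eval_dense[OF s] by blast
  \<comment> \<open>Averaging with the reflection keeps the first coefficients, because those of \<open>G\<close> have the right parity.\<close>
  define H where "H = loop_scale sc (1 / 2) (F + loop_reflect F)"
  have "loop_reflect H = H"
    by (intro poly_mapping_eqI)
       (simp add: H_def lookup_loop_reflect lookup_loop_scale lookup_add \<omega>_add \<omega>_scale \<omega>_involution add.commute)
  moreover have "loop_eval s H k = G k" if "k \<le> N" for k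
  proof -
    have "loop_eval s H k = sc (1 / 2) (G k + sc ((- 1) ^ k * (- 1) ^ k) (G k))"
      using F G that by (simp add: H_def loop_eval_scale series_scale_def loop_eval_add loop_eval_reflect[OF s]
          parity_series_def)
    also have "sc ((- 1) ^ k * (- 1) ^ k) (G k) = G k"
      by (simp flip: power_mult_distrib)
    also have "G k + G k = sc 2 (G k)"
      using scale_left_distrib[of 1 1 "G k"] by simp
    finally show ?thesis by simp
  qed
  ultimately show ?thesis by blast
qed

end

section \<open>The Cartan--Chevalley involution of the affine algebra\<close>

context lie_type
begin

lemma loop_tensor_tpow: "loop_tensor sc (tpow n) x = Poly_Mapping.single n x"
  by (intro poly_mapping_eqI) (simp add: lookup_loop_tensor[OF lie] tpow_def lookup_single when_def)

lemma loop_tensor_plus_minus: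
  "loop_tensor sc (tpow n + tpow (- n)) x = Poly_Mapping.single n x + Poly_Mapping.single (- n) x"
  "loop_tensor sc (tpow n - tpow (- n)) x = Poly_Mapping.single n x - Poly_Mapping.single (- n) x"
  using scale_left_distrib[of 1 1 x]
  by (auto intro!: poly_mapping_eqI
      simp: lookup_loop_tensor[OF lie] lookup_add lookup_minus tpow_def lookup_single when_def)

lemma loop_eval_plus_minus:
  "loop_eval s (loop_tensor sc (tpow (int n) + tpow (- int n)) x)
     = series_tensor sc (fps_const (s ^ n) * plus_series n) x"
  "loop_eval s (loop_tensor sc (tpow (int n) - tpow (- int n)) x)
     = series_tensor sc (fps_const (s ^ n) * minus_series n) x"
proof -
  have "loop_eval s (F - G) = loop_eval s F - loop_eval s G" for F G
    using loop_eval_add[of s "F - G" G] by simp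
  thus "loop_eval s (loop_tensor sc (tpow (int n) + tpow (- int n)) x)
     = series_tensor sc (fps_const (s ^ n) * plus_series n) x"
    "loop_eval s (loop_tensor sc (tpow (int n) - tpow (- int n)) x)
     = series_tensor sc (fps_const (s ^ n) * minus_series n) x"
    unfolding cayley_power_plus_minus[symmetric] loop_tensor_plus_minus
    by (auto simp: loop_eval_add loop_eval_single series_tensor_def fun_eq_iff scale_left_distrib
        scale_left_diff_distrib)
qed

lemma loop_bracket_single:
  "loop_bracket br (Poly_Mapping.single m x) (Poly_Mapping.single n y) = Poly_Mapping.single (m + n) (br x y)"
  using loop_bracket_tensor[OF lie, of "tpow m" x "tpow n" y]
  by (simp add: loop_tensor_tpow tpow_def mult_single) (simp add: loop_tensor_tpow flip: tpow_def)

lemma affine_algebra_simps: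
  "lcarrier (affine_algebra sc br B) = UNIV"
  "lzero (affine_algebra sc br B) = 0"
  "ladd (affine_algebra sc br B) z w = z + w"
  "lscale (affine_algebra sc br B) c (F, a, b) = (loop_scale sc c F, c * a, c * b)"
  "lbracket (affine_algebra sc br B) (F, a, b) (G, a', b')
     = (loop_bracket br F G + loop_scale sc b (loop_degree sc G) - loop_scale sc b' (loop_degree sc F),
        loop_cocycle B F G, 0)"
  by (simp_all add: affine_algebra_def lie_of_def)

lemma affine_bracket_derivation:
  "lbracket (affine_algebra sc br B) (0, 0, b) (F, a', b') = (loop_scale sc b (loop_degree sc F), 0, 0)"
proof -
  have "loop_scale sc b' (loop_degree sc 0) = 0"
    by (simp add: loop_scale_def loop_degree_def)
  thus ?thesis
    by (simp add: affine_algebra_simps loop_bracket_def loop_cocycle_def)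
qed

end

text \<open>What is used of the affine algebra and its generators: \<open>\<Omega>\<close> is a homomorphism that negates the centre
  and the derivation, it acts by \<open>\<omega>\<close> on generators of the constant loops, and it acts by \<open>\<omega>\<close> and
  \<open>t \<mapsto> 1 / t\<close> on at least one nonzero vector in each of the degrees 1 and -1.\<close>

locale affine_involution = involutive_lie_type sc br \<omega>
  for sc :: "'k::field_char_0 \<Rightarrow> 'a::ab_group_add \<Rightarrow> 'a" and br :: "'a \<Rightarrow> 'a \<Rightarrow> 'a" and \<omega> +
  fixes B :: "'a \<Rightarrow> 'a \<Rightarrow> 'k" and \<Omega> :: "('k, 'a) affine \<Rightarrow> ('k, 'a) affine"
  assumes nonabelian: "\<exists>x y. br x y \<noteq> 0"
    and simple: "subspace I \<Longrightarrow> (\<And>x y. y \<in> I \<Longrightarrow> br x y \<in> I) \<Longrightarrow> I = {0} \<or> I = UNIV"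
    and \<Omega>_hom: "lie_hom \<Omega> (affine_algebra sc br B) (affine_algebra sc br B)"
    and \<Omega>_centre_derivation: "\<Omega> (0, a, b) = (0, - a, - b)"
    and \<Omega>_degree_0: "\<exists>X. generated_subalgebra sc br X = UNIV \<and>
          (\<forall>x \<in> X. \<Omega> (in_affine (Poly_Mapping.single 0 x)) = in_affine (Poly_Mapping.single 0 (\<omega> x)))"
    and \<Omega>_degree_1: "n \<in> {1, - 1} \<Longrightarrow> \<exists>x. x \<noteq> 0 \<and>
          \<Omega> (in_affine (Poly_Mapping.single n x)) = in_affine (Poly_Mapping.single (- n) (\<omega> x))"
begin

text \<open>A subspace that contains all brackets is an ideal, so in a simple Lie algebra it is everything.\<close>

lemma perfect:
  assumes "subspace S" "\<And>x y. br x y \<in> S"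
  shows "x \<in> S"
proof -
  have "S = {0} \<or> S = UNIV"
    using assms by (intro simple) auto
  moreover have "S \<noteq> {0}"
    using nonabelian assms(2) by blast
  ultimately show ?thesis by blast
qed

lemma \<Omega>_add: "\<Omega> (z + w) = \<Omega> z + \<Omega> w"
  using \<Omega>_hom unfolding lie_hom_def linear_between_def affine_algebra_simps(1-3) by blast

lemma \<Omega>_scale: "\<Omega> (lscale (affine_algebra sc br B) c z) = lscale (affine_algebra sc br B) c (\<Omega> z)"
  using \<Omega>_hom unfolding lie_hom_def linear_between_def affine_algebra_simps(1-3) by blast

lemma \<Omega>_bracket:
  "\<Omega> (lbracket (affine_algebra sc br B) z w) = lbracket (affine_algebra sc br B) (\<Omega> z) (\<Omega> w)"
  using \<Omega>_hom unfolding lie_hom_def affine_algebra_simps(1-3) by blast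

text \<open>The components of \<open>\<Omega> (t^n \<otimes> x)\<close>: the coefficient of \<open>t^(-n)\<close> and the coefficients of the central
  element and of the derivation. The other coefficients of the loop turn out to vanish.\<close>

definition loop_part :: "int \<Rightarrow> 'a \<Rightarrow> 'a" where
  "loop_part n x = Poly_Mapping.lookup (fst (\<Omega> (in_affine (Poly_Mapping.single n x)))) (- n)"

definition centre_part :: "int \<Rightarrow> 'a \<Rightarrow> 'k" where
  "centre_part n x = fst (snd (\<Omega> (in_affine (Poly_Mapping.single n x))))"

definition derivation_part :: "int \<Rightarrow> 'a \<Rightarrow> 'k" where
  "derivation_part n x = snd (snd (\<Omega> (in_affine (Poly_Mapping.single n x))))"

lemmas part_defs = loop_part_def centre_part_def derivation_part_def

lemma parts_add:
  "loop_part n (x + y) = loop_part n x + loop_part n y"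
  "centre_part n (x + y) = centre_part n x + centre_part n y"
  "derivation_part n (x + y) = derivation_part n x + derivation_part n y"
proof -
  have "in_affine (Poly_Mapping.single n (x + y))
      = in_affine (Poly_Mapping.single n x) + (in_affine (Poly_Mapping.single n y) :: ('k, 'a) affine)"
    by (simp add: in_affine_def single_add)
  thus "loop_part n (x + y) = loop_part n x + loop_part n y"
    "centre_part n (x + y) = centre_part n x + centre_part n y"
    "derivation_part n (x + y) = derivation_part n x + derivation_part n y"
    by (simp_all add: part_defs \<Omega>_add lookup_add)
qed

lemma parts_scale:
  "loop_part n (sc c x) = sc c (loop_part n x)"
  "centre_part n (sc c x) = c * centre_part n x"
  "derivation_part n (sc c x) = c * derivation_part n x"
proof -
  have eq: "in_affine (Poly_Mapping.single n (sc c x))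
      = lscale (affine_algebra sc br B) c (in_affine (Poly_Mapping.single n x))"
    by (simp add: in_affine_def affine_algebra_simps loop_scale_single)
  show "loop_part n (sc c x) = sc c (loop_part n x)"
    "centre_part n (sc c x) = c * centre_part n x"
    "derivation_part n (sc c x) = c * derivation_part n x"
    unfolding part_defs eq \<Omega>_scale
    by (cases "\<Omega> (in_affine (Poly_Mapping.single n x))"; simp add: affine_algebra_simps lookup_loop_scale)+
qed

text \<open>As \<open>\<Omega>\<close> negates the derivation \<open>d\<close>, it maps the eigenspace of \<open>ad d\<close> for \<open>n\<close> to the one for \<open>-n\<close>.
  For \<open>n \<noteq> 0\<close> this eigenspace consists of loops only.\<close>

lemma \<Omega>_single:
  "\<Omega> (in_affine (Poly_Mapping.single n x))
     = (Poly_Mapping.single (- n) (loop_part n x), centre_part n x, derivation_part n x)"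
  and parts_nonzero_degree: "n \<noteq> 0 \<Longrightarrow> centre_part n x = 0" "n \<noteq> 0 \<Longrightarrow> derivation_part n x = 0"
proof -
  obtain G p r where G: "\<Omega> (in_affine (Poly_Mapping.single n x)) = (G, p, r)"
    by (cases "\<Omega> (in_affine (Poly_Mapping.single n x))")
  \<comment> \<open>Apply \<open>\<Omega>\<close> to \<open>n (t^n \<otimes> x) = [d, t^n \<otimes> x]\<close>.\<close>
  have "lscale (affine_algebra sc br B) (of_int n) (in_affine (Poly_Mapping.single n x))
      = lbracket (affine_algebra sc br B) (0, 0, 1) (in_affine (Poly_Mapping.single n x))"
    unfolding in_affine_def affine_bracket_derivation
    by (simp add: affine_algebra_simps loop_scale_single loop_degree_single)
  hence "\<Omega> (lscale (affine_algebra sc br B) (of_int n) (in_affine (Poly_Mapping.single n x)))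
      = lbracket (affine_algebra sc br B) (\<Omega> (0, 0, 1)) (\<Omega> (in_affine (Poly_Mapping.single n x)))"
    by (simp only: \<Omega>_bracket)
  hence "(loop_scale sc (of_int n) G, of_int n * p, of_int n * r) = (loop_scale sc (- 1) (loop_degree sc G), 0, 0)"
    unfolding \<Omega>_scale \<Omega>_centre_derivation G by (simp add: affine_bracket_derivation affine_algebra_simps(4))
  hence eq: "loop_scale sc (of_int n) G = loop_scale sc (- 1) (loop_degree sc G)"
    and p: "of_int n * p = 0" and r: "of_int n * r = 0" by simp_all
  have "sc (of_int (n + m)) (Poly_Mapping.lookup G m) = 0" for m
    using arg_cong[OF eq, of "\<lambda>F. Poly_Mapping.lookup F m"]
    by (simp add: lookup_loop_scale lookup_loop_degree scale_left_distrib)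
  hence zero: "Poly_Mapping.lookup G m = 0" if "m \<noteq> - n" for m
    using that by (metis add.commute add_eq_0_iff of_int_eq_0_iff scale_eq_0_iff)
  have "G = Poly_Mapping.single (- n) (Poly_Mapping.lookup G (- n))"
    by (intro poly_mapping_eqI) (auto simp: lookup_single when_def zero)
  thus "\<Omega> (in_affine (Poly_Mapping.single n x))
     = (Poly_Mapping.single (- n) (loop_part n x), centre_part n x, derivation_part n x)"
    by (simp add: part_defs G)
  show "n \<noteq> 0 \<Longrightarrow> centre_part n x = 0" "n \<noteq> 0 \<Longrightarrow> derivation_part n x = 0"
    using p r by (simp_all add: part_defs G)
qed

text \<open>The cocycle contributes a central term, which \<open>\<Omega>\<close> negates. Comparing the three components of both
  sides gives the next three lemmas.\<close>

lemma \<Omega>_bracket_single: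
  defines "\<kappa> m n x y \<equiv> loop_cocycle B (Poly_Mapping.single m x) (Poly_Mapping.single n y)"
  shows "\<Omega> (in_affine (Poly_Mapping.single (m + n) (br x y))) + (0, - \<kappa> m n x y, 0)
    = lbracket (affine_algebra sc br B) (\<Omega> (in_affine (Poly_Mapping.single m x)))
        (\<Omega> (in_affine (Poly_Mapping.single n y)))"
proof -
  have "lbracket (affine_algebra sc br B) (in_affine (Poly_Mapping.single m x)) (in_affine (Poly_Mapping.single n y))
      = in_affine (Poly_Mapping.single (m + n) (br x y)) + (0, \<kappa> m n x y, 0)"
    by (simp add: in_affine_def affine_algebra_simps loop_bracket_single \<kappa>_def)
  thus ?thesis
    by (metis \<Omega>_add \<Omega>_bracket \<Omega>_centre_derivation minus_zero)
qed

lemma derivation_part_eq_0: "derivation_part n x = 0"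
proof -
  have "derivation_part n (br x y) = 0" for x y
    using \<Omega>_bracket_single[of 0 n x y] by (simp add: \<Omega>_single affine_algebra_simps)
  moreover have "subspace {x. derivation_part n x = 0}"
    using parts_add(3)[of n 0 0] by (auto simp: subspace_def parts_add parts_scale)
  ultimately show ?thesis using perfect[of "{x. derivation_part n x = 0}"] by blast
qed

lemma centre_part_eq_0: "centre_part n x = 0"
proof (cases "n = 0")
  case True
  \<comment> \<open>In degree 0 the cocycle vanishes on both sides.\<close>
  have "centre_part 0 (br x y) = 0" for x y
    using \<Omega>_bracket_single[of 0 0 x y]
    by (simp add: \<Omega>_single affine_algebra_simps loop_cocycle_def split: if_splits)
  moreover have "subspace {x. centre_part 0 x = 0}"
    using parts_add(2)[of 0 0 0] by (auto simp: subspace_def parts_add parts_scale)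
  ultimately show ?thesis using perfect[of "{x. centre_part 0 x = 0}"] True by blast
qed (simp add: parts_nonzero_degree)

lemma loop_part_br: "loop_part (m + n) (br x y) = br (loop_part m x) (loop_part n y)"
proof -
  have "Poly_Mapping.single (- (m + n)) (loop_part (m + n) (br x y))
      = Poly_Mapping.single (- m + - n) (br (loop_part m x) (loop_part n y))"
    using \<Omega>_bracket_single[of m n x y]
    by (simp add: \<Omega>_single affine_algebra_simps derivation_part_eq_0 loop_bracket_single)
  thus ?thesis
    by (metis lookup_single_eq minus_add_distrib)
qed

lemma subspace_agree: "subspace {x. loop_part n x = \<omega> x}"
  using parts_add(1)[of n 0 0] by (auto simp: subspace_def parts_add parts_scale \<omega>_add \<omega>_scale)

lemma loop_part_0: "loop_part 0 x = \<omega> x"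
proof -
  obtain X where X: "generated_subalgebra sc br X = UNIV"
    "\<And>x. x \<in> X \<Longrightarrow> \<Omega> (in_affine (Poly_Mapping.single 0 x)) = in_affine (Poly_Mapping.single 0 (\<omega> x))"
    using \<Omega>_degree_0 by blast
  have "X \<subseteq> {x. loop_part 0 x = \<omega> x}"
    using X(2) by (auto simp: loop_part_def) (simp add: in_affine_def)
  moreover have "br x y \<in> {x. loop_part 0 x = \<omega> x}" if "loop_part 0 x = \<omega> x" "loop_part 0 y = \<omega> y" for x y
    using loop_part_br[of 0 0 x y] that by (simp add: \<omega>_br)
  ultimately have "generated_subalgebra sc br X \<subseteq> {x. loop_part 0 x = \<omega> x}"
    unfolding generated_subalgebra_def using subspace_agree[of 0] by (intro Inter_lower) auto
  thus ?thesis using X(1) by blast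
qed

text \<open>Because \<open>\<Omega>\<close> is already known in degree 0, the vectors on which it agrees with \<open>\<omega>\<close> in degree
  \<open>\<plusminus>1\<close> form an ideal. It contains the nonzero vector given by the affine node.\<close>

lemma loop_part_1:
  assumes "n \<in> {1, - 1}"
  shows "loop_part n x = \<omega> x"
proof -
  obtain z where z: "z \<noteq> 0"
    "\<Omega> (in_affine (Poly_Mapping.single n z)) = in_affine (Poly_Mapping.single (- n) (\<omega> z))"
    using \<Omega>_degree_1[OF assms] by blast
  have "z \<in> {x. loop_part n x = \<omega> x}"
    by (simp add: loop_part_def z) (simp add: in_affine_def)
  moreover have "br x y \<in> {x. loop_part n x = \<omega> x}" if "y \<in> {x. loop_part n x = \<omega> x}" for x y
    using loop_part_br[of 0 n x y] that by (simp add: loop_part_0 \<omega>_br)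
  ultimately show ?thesis
    using simple[OF subspace_agree[of n]] z(1) by blast
qed

text \<open>Every element of degree \<open>n \<plusminus> 1\<close> is a sum of brackets of elements of degrees \<open>n\<close> and \<open>\<plusminus>1\<close>, so
  agreement spreads from degrees 0, 1 and -1 to all degrees.\<close>

lemma loop_part_eq: "loop_part n x = \<omega> x"
proof -
  have step: "loop_part (n + m) x = \<omega> x" if m: "m \<in> {1, - 1}" and n: "\<And>x. loop_part n x = \<omega> x" for m n x
  proof -
    have "br x y \<in> {x. loop_part (n + m) x = \<omega> x}" for x y
      by (simp add: loop_part_br n loop_part_1[OF m] \<omega>_br)
    thus ?thesis using perfect[OF subspace_agree[of "n + m"]] by blast
  qed
  show ?thesis
  proof (induction n arbitrary: x rule: int_induct[where k = 0])
    case (step1 i)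
    show ?case by (rule step) (simp_all add: step1)
  next
    case (step2 i)
    show ?case using step[of "- 1" i] by (simp add: step2)
  qed (rule loop_part_0)
qed

lemma \<Omega>_eq: "\<Omega> (F, a, b) = (loop_reflect F, - a, - b)"
proof -
  have zero: "\<Omega> 0 = 0"
    using \<Omega>_centre_derivation[of 0 0] by (simp add: zero_prod_def)
  have sum: "\<Omega> (\<Sum>i\<in>I. z i) = (\<Sum>i\<in>I. \<Omega> (z i))" for I :: "int set" and z
    by (induction I rule: infinite_finite_induct) (simp_all add: zero \<Omega>_add)
  have in_sum: "in_affine (\<Sum>i\<in>I. G i) = (\<Sum>i\<in>I. in_affine (G i) :: ('k, 'a) affine)" for I :: "int set" and G
    by (induction I rule: infinite_finite_induct) (simp_all add: in_affine_def zero_prod_def, metis add_Pair add_0)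
  have "\<Omega> (in_affine F) = \<Omega> (in_affine (\<Sum>n\<in>Poly_Mapping.keys F. Poly_Mapping.single n (Poly_Mapping.lookup F n)))"
    by (simp flip: poly_mapping_eq_sum_single)
  also have "\<dots> = (\<Sum>n\<in>Poly_Mapping.keys F. in_affine (Poly_Mapping.single (- n) (\<omega> (Poly_Mapping.lookup F n))))"
    unfolding in_sum sum \<Omega>_single
    by (simp add: loop_part_eq centre_part_eq_0 derivation_part_eq_0 in_affine_def)
  also have "\<dots> = in_affine (loop_reflect F)"
    by (simp add: loop_reflect_def in_sum)
  finally have "\<Omega> (in_affine F) = in_affine (loop_reflect F)" .
  moreover have "(F, a, b) = in_affine F + (0, a, b)"
    by (simp add: in_affine_def)
  ultimately show ?thesis
    by (simp only: \<Omega>_add \<Omega>_centre_derivation) (simp add: in_affine_def)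
qed

text \<open>The centre and the derivation are negated and contribute nothing to the fixed points; this is how
  the fixed subalgebra comes to be realised inside the loop algebra.\<close>

lemma fixed_carrier:
  "lcarrier (fixed_subalgebra (affine_algebra sc br B) \<Omega>) = {in_affine F | F. loop_reflect F = F}"
proof -
  have "- a = a \<longleftrightarrow> a = 0" for a :: 'k
    by (metis add.right_inverse add.inverse_neutral mult_2 mult_eq_0_iff zero_neq_numeral)
  thus ?thesis
    by (auto simp: fixed_subalgebra_def lie_restrict_def affine_algebra_simps \<Omega>_eq in_affine_def)
qed

end

section \<open>The Cayley map on the fixed subalgebra\<close>

context affine_involution
begin

abbreviation fixed :: "('k, ('k, 'a) affine) lie_struct" where
  "fixed \<equiv> fixed_subalgebra (affine_algebra sc br B) \<Omega>"

definition cayley_map :: "'k \<Rightarrow> ('k, 'a) affine \<Rightarrow> nat \<Rightarrow> 'a" where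
  "cayley_map s z = loop_eval s (fst z)"

lemma fixed_ops:
  "lzero fixed = 0"
  "ladd fixed z w = z + w"
  "lscale fixed c z = lscale (affine_algebra sc br B) c z"
  "lbracket fixed z w = lbracket (affine_algebra sc br B) z w"
  by (simp_all add: fixed_subalgebra_def lie_restrict_def affine_algebra_simps)

lemma N_series_ops:
  "lcarrier (N_series sc br \<omega>) = parity_series"
  "ladd (N_series sc br \<omega>) F G = F + G"
  "lscale (N_series sc br \<omega>) c F = series_scale sc c F"
  "lbracket (N_series sc br \<omega>) F G = series_bracket br F G"
  by (simp_all add: N_series_eq lie_restrict_def lie_of_def)

lemma lie_algebra_fixed: "lie_algebra fixed"
proof -
  have "\<Omega> 0 = 0"
    using \<Omega>_centre_derivation[of 0 0] by (simp add: zero_prod_def)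
  thus ?thesis
    unfolding fixed_subalgebra_def using \<Omega>_hom
    by (intro lie_algebra_restrict)
       (simp_all add: lie_hom_def affine_algebra_simps(1-3) \<Omega>_add \<Omega>_scale \<Omega>_bracket)
qed

lemma cayley_map_linear:
  assumes "s * s = 1"
  shows "linear_between (cayley_map s) fixed (N_series sc br \<omega>)"
  using loop_eval_parity[OF assms]
  by (auto simp: linear_between_def fixed_carrier fixed_ops N_series_ops cayley_map_def loop_eval_add
      in_affine_def affine_algebra_simps loop_eval_scale)

lemma cayley_map_mono:
  assumes s: "s * s = 1"
  shows "lie_mono (cayley_map s) fixed (N_series sc br \<omega>)"
proof -
  have "cayley_map s (lbracket fixed z w) = lbracket (N_series sc br \<omega>) (cayley_map s z) (cayley_map s w)"
    if "z \<in> lcarrier fixed" "w \<in> lcarrier fixed" for z w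
    using that by (auto simp: fixed_carrier fixed_ops N_series_ops cayley_map_def in_affine_def
        affine_algebra_simps loop_eval_bracket[OF s])
  moreover have "inj_on (cayley_map s) (lcarrier fixed)"
  proof (rule inj_onI)
    fix z w assume "z \<in> lcarrier fixed" "w \<in> lcarrier fixed" and eq: "cayley_map s z = cayley_map s w"
    then obtain F G where z: "z = in_affine F" "w = in_affine G" by (auto simp: fixed_carrier)
    have "loop_eval s (F - G) + loop_eval s G = loop_eval s F"
      by (simp flip: loop_eval_add)
    hence "loop_eval s (F - G) = 0"
      using eq by (simp add: z cayley_map_def in_affine_def)
    hence "F - G = 0" by (rule loop_eval_eq_0[OF s])
    thus "z = w" by (simp add: z)
  qed
  ultimately show ?thesis
    using lie_algebra_fixed lie_algebra_N_series cayley_map_linear[OF s]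
    by (simp add: lie_mono_def lie_hom_def)
qed

lemma cayley_map_is_rho:
  assumes "s * s = 1"
  shows "is_rho sc br \<omega> s fixed (cayley_map s)"
  using cayley_map_linear[OF assms]
  by (simp add: is_rho_def cayley_map_def in_affine_def loop_eval_plus_minus)

text \<open>A fixed loop is half the sum of the elements \<open>t^n \<otimes> v + t^(-n) \<otimes> \<omega> v\<close> over its terms \<open>t^n \<otimes> v\<close>.
  Splitting \<open>v\<close> into eigenvectors \<open>x\<close> and \<open>y\<close> turns each of them into
  \<open>(t^n + t^(-n)) \<otimes> x + (t^n - t^(-n)) \<otimes> y\<close>, so these elements span the fixed subalgebra. For negative
  \<open>n\<close> the roles of \<open>v\<close> and \<open>\<omega> v\<close> are exchanged.\<close>

lemma is_rho_unique:
  assumes s: "s * s = 1" and \<rho>: "is_rho sc br \<omega> s fixed \<rho>" and z: "z \<in> lcarrier fixed"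
  shows "\<rho> z = cayley_map s z"
proof -
  define E where "E = {F. loop_reflect F = F \<and> \<rho> (in_affine F) = loop_eval s F}"
  have lin: "linear_between \<rho> fixed (N_series sc br \<omega>)"
    using \<rho> by (simp add: is_rho_def)
  have in_fixed: "in_affine F \<in> lcarrier fixed" if "loop_reflect F = F" for F
    using that by (auto simp: fixed_carrier)
  have add: "F + G \<in> E" if "F \<in> E" "G \<in> E" for F G
  proof -
    have "in_affine (F + G) = in_affine F + (in_affine G :: ('k, 'a) affine)"
      by (simp add: in_affine_def)
    moreover have "loop_reflect (F + G) = F + G"
      using that by (simp add: E_def loop_reflect_add)
    ultimately show ?thesis
      using that lin in_fixed
      by (auto simp: E_def linear_between_def fixed_ops N_series_ops loop_eval_add)
  qed
  have scale: "loop_scale sc c F \<in> E" if "F \<in> E" for c F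
  proof -
    have "in_affine (loop_scale sc c F) = lscale fixed c (in_affine F :: ('k, 'a) affine)"
      by (simp add: in_affine_def fixed_ops affine_algebra_simps)
    moreover have "loop_reflect (loop_scale sc c F) = loop_scale sc c F"
      using that by (simp add: E_def loop_reflect_scale)
    ultimately show ?thesis
      using that lin in_fixed
      by (auto simp: E_def linear_between_def N_series_ops loop_eval_scale)
  qed
  have zero: "0 \<in> E"
  proof -
    have fixed0: "loop_reflect 0 = 0"
      by (simp add: loop_reflect_def)
    have "\<rho> (lscale fixed 0 (in_affine 0)) = lscale (N_series sc br \<omega>) 0 (\<rho> (in_affine 0))"
      using lin in_fixed[OF fixed0] by (auto simp: linear_between_def)
    moreover have "lscale fixed 0 (in_affine 0) = (in_affine 0 :: ('k, 'a) affine)"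
      by (simp add: in_affine_def fixed_ops affine_algebra_simps loop_scale_def)
    ultimately show ?thesis
      by (simp add: E_def fixed0 N_series_ops series_scale_def fun_eq_iff)
  qed
  have nonneg: "Poly_Mapping.single n v + Poly_Mapping.single (- n) (\<omega> v) \<in> E" if "n \<ge> 0" for n v
  proof -
    define m where "m = nat n"
    have n: "n = int m" using that by (simp add: m_def)
    \<comment> \<open>The components of \<open>v\<close> in the two eigenspaces of \<open>\<omega>\<close>.\<close>
    define x where "x = sc (1 / 2) (v + \<omega> v)"
    define y where "y = sc (1 / 2) (v - \<omega> v)"
    have half: "sc (1 / 2) u + sc (1 / 2) u = u" for u
      using scale_left_distrib[of "1 / 2" "1 / 2" u] by simp
    have \<omega>_diff: "\<omega> (a - b) = \<omega> a - \<omega> b" for a b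
      using \<omega>_add[of "a - b" b] by simp
    have "x + y = sc (1 / 2) v + sc (1 / 2) v" "x - y = sc (1 / 2) (\<omega> v) + sc (1 / 2) (\<omega> v)"
      by (simp_all add: x_def y_def scale_right_distrib scale_right_diff_distrib)
    moreover have "\<omega> x = x" "\<omega> y = - y"
      by (simp_all add: x_def y_def \<omega>_scale \<omega>_add \<omega>_diff \<omega>_involution scale_right_distrib
          scale_right_diff_distrib)
    ultimately have xy: "\<omega> x = x" "\<omega> y = - y" "x + y = v" "x - y = \<omega> v"
      by (simp_all only: half)
    have plus: "loop_tensor sc (tpow n + tpow (- n)) x \<in> E"
    proof -
      have "loop_reflect (loop_tensor sc (tpow n + tpow (- n)) x) = loop_tensor sc (tpow n + tpow (- n)) x"
        by (intro poly_mapping_eqI)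
           (auto simp: loop_tensor_plus_minus lookup_loop_reflect lookup_add lookup_single when_def \<omega>_add xy)
      thus ?thesis
        using \<rho> xy unfolding n by (simp add: E_def is_rho_def plus_eigenspace_def loop_eval_plus_minus)
    qed
    have minus: "loop_tensor sc (tpow n - tpow (- n)) y \<in> E"
    proof -
      have "loop_reflect (loop_tensor sc (tpow n - tpow (- n)) y) = loop_tensor sc (tpow n - tpow (- n)) y"
        by (intro poly_mapping_eqI)
           (auto simp: loop_tensor_plus_minus lookup_loop_reflect lookup_minus lookup_single when_def \<omega>_minus xy)
      thus ?thesis
        using \<rho> xy unfolding n by (simp add: E_def is_rho_def minus_eigenspace_def loop_eval_plus_minus)
    qed
    have "Poly_Mapping.single n v + Poly_Mapping.single (- n) (\<omega> v)
        = loop_tensor sc (tpow n + tpow (- n)) x + loop_tensor sc (tpow n - tpow (- n)) y"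
      unfolding xy(4)[symmetric] unfolding xy(3)[symmetric] loop_tensor_plus_minus by (simp add: single_add single_diff)
    thus ?thesis using add[OF plus minus] by simp
  qed
  have pair: "Poly_Mapping.single n v + Poly_Mapping.single (- n) (\<omega> v) \<in> E" for n v
    using nonneg[of n v] nonneg[of "- n" "\<omega> v"] by (cases "n \<ge> 0") (simp_all add: \<omega>_involution add.commute)
  obtain F where F: "z = in_affine F" "loop_reflect F = F"
    using z by (auto simp: fixed_carrier)
  have "F = loop_scale sc (1 / 2) (F + loop_reflect F)"
  proof (rule poly_mapping_eqI)
    fix n
    show "Poly_Mapping.lookup F n = Poly_Mapping.lookup (loop_scale sc (1 / 2) (F + loop_reflect F)) n"
      using scale_left_distrib[of "1 / 2" "1 / 2" "Poly_Mapping.lookup F n"]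
      by (simp add: F(2) lookup_loop_scale lookup_add scale_right_distrib)
  qed
  also have "F + loop_reflect F = (\<Sum>n\<in>Poly_Mapping.keys F.
      Poly_Mapping.single n (Poly_Mapping.lookup F n) + Poly_Mapping.single (- n) (\<omega> (Poly_Mapping.lookup F n)))"
    unfolding sum.distrib by (simp add: loop_reflect_def flip: poly_mapping_eq_sum_single)
  also have "loop_scale sc (1 / 2) \<dots> \<in> E"
  proof (rule scale)
    have "(\<Sum>n\<in>I. Poly_Mapping.single n (Poly_Mapping.lookup F n)
        + Poly_Mapping.single (- n) (\<omega> (Poly_Mapping.lookup F n))) \<in> E" for I
      by (induction I rule: infinite_finite_induct) (simp_all add: zero add pair)
    thus "(\<Sum>n\<in>Poly_Mapping.keys F. Poly_Mapping.single n (Poly_Mapping.lookup F n)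
        + Poly_Mapping.single (- n) (\<omega> (Poly_Mapping.lookup F n))) \<in> E" .
  qed
  finally show ?thesis
    by (simp add: E_def F(1) cayley_map_def) (simp add: in_affine_def)
qed

text \<open>If \<open>\<omega>\<close> were \<open>-1\<close>, compatibility with the bracket would give \<open>- [x, y] = [x, y]\<close>.\<close>

lemma plus_eigenspace_nonzero: "\<exists>x. x \<noteq> 0 \<and> \<omega> x = x"
proof (rule ccontr)
  assume none: "\<not> ?thesis"
  have neg: "\<omega> x = - x" for x
  proof -
    have "\<omega> (x + \<omega> x) = x + \<omega> x" by (simp add: \<omega>_add \<omega>_involution add.commute)
    hence "x + \<omega> x = 0" using none by blast
    thus ?thesis by (simp add: eq_neg_iff_add_eq_0 add.commute)
  qed
  have "br x y = 0" for x y
    using \<omega>_br[of x y] by (intro eq_uminus_self) (simp add: neg br_minus)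
  thus False using nonabelian by blast
qed

lemma cayley_map_not_surjective:
  assumes s: "s * s = 1"
  shows "cayley_map s ` lcarrier fixed \<noteq> lcarrier (N_series sc br \<omega>)"
proof -
  obtain x where x: "x \<noteq> 0" "\<omega> x = x" using plus_eigenspace_nonzero by blast
  \<comment> \<open>The index \<open>2 ^ 0\<close> is left out because it is odd.\<close>
  define G where "G = (\<lambda>k::nat. if \<exists>m\<ge>1. k = 2 ^ m then x else 0)"
  have "even k" if "\<exists>m\<ge>1. k = 2 ^ m" for k :: nat
    using that by auto
  hence "G \<in> parity_series"
    by (auto simp: G_def parity_series_def x)
  moreover have "G \<notin> cayley_map s ` lcarrier fixed"
  proof
    assume "G \<in> cayley_map s ` lcarrier fixed"
    then obtain z where "G = cayley_map s z" by blast
    thus False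
      using loop_eval_not_lacunary[OF s x(1), of "fst z"] unfolding G_def cayley_map_def by argo
  qed
  ultimately show ?thesis
    unfolding N_series_ops(1) by metis
qed

text \<open>Any prescribed coefficients up to \<open>N\<close> are attained by a loop; if they have the right parity, then also
  by a fixed loop.\<close>

lemma trunc_cayley_map_epi:
  assumes s: "s * s = 1"
  shows "lie_epi (trunc_proj sc br N \<circ> cayley_map s) fixed (N_trunc sc br \<omega> N)"
proof -
  have \<rho>: "lie_hom (cayley_map s) fixed (N_series sc br \<omega>)"
    using cayley_map_mono[OF s] by (simp add: lie_mono_def)
  have "lie_hom (trunc_proj sc br N \<circ> cayley_map s) fixed (N_trunc sc br \<omega> N)"
    using \<rho> trunc_proj_lie_hom[of N] unfolding lie_hom_def linear_between_def by simp
  moreover have "trunc_proj sc br N G \<in> trunc_proj sc br N ` cayley_map s ` lcarrier fixed"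
    if "G \<in> parity_series" for G
  proof -
    obtain F where F: "loop_reflect F = F" "\<forall>k\<le>N. loop_eval s F k = G k"
      using loop_reflect_dense[OF s \<open>G \<in> _\<close>] by blast
    have "trunc_proj sc br N (cayley_map s (in_affine F)) = trunc_proj sc br N G"
      using F(2) by (simp add: trunc_proj_eq_iff cayley_map_def in_affine_def)
    moreover have "in_affine F \<in> lcarrier fixed" using F(1) by (auto simp: fixed_carrier)
    ultimately show ?thesis by (metis imageI)
  qed
  moreover have "cayley_map s ` lcarrier fixed \<subseteq> parity_series"
    using cayley_map_linear[OF s] by (auto simp: linear_between_def N_series_ops)
  ultimately show ?thesis
    unfolding lie_epi_def N_trunc_carrier image_comp[symmetric] by blast
qed

end

section \<open>Passage from the generators to the whole algebra\<close>

text \<open>The Chevalley relations alone allow zero vectors. By indecomposability the set of nodes with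
  \<open>e i \<noteq> 0\<close> is empty or everything, and if it were empty, the generated algebra would be zero.\<close>

lemma extended_generators_nonzero:
  fixes sc :: "'k::field_char_0 \<Rightarrow> 'a::ab_group_add \<Rightarrow> 'a"
  assumes "lie_type sc br" and ncomm: "\<exists>x y. br x y \<noteq> 0"
    and gcm: "gen_cartan_matrix l A" and indec: "indecomposable l A"
    and rel: "chevalley_relations sc br {0..l} A e f h"
    and gen: "generated_subalgebra sc br (e ` {1..l} \<union> f ` {1..l}) = UNIV"
    and f: "\<And>i. i \<in> {1..l} \<Longrightarrow> e i = 0 \<Longrightarrow> f i = 0"
  shows "e 0 \<noteq> 0"
proof
  assume e0: "e 0 = 0"
  interpret lie_type sc br by fact
  \<comment> \<open>\<open>e i = 0\<close> forces \<open>h i = 0\<close>, and then \<open>A i j = 0\<close> whenever \<open>e j \<noteq> 0\<close>.\<close>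
  define J where "J = {i \<in> {0..l}. e i \<noteq> 0}"
  have split: "A i j = 0 \<and> A j i = 0" if "i \<in> {0..l} - J" and "j \<in> J" for i j
  proof -
    have i: "i \<le> l" "e i = 0" and j: "j \<le> l" "e j \<noteq> 0"
      using that by (simp_all add: J_def)
    have "br (e i) (f i) = h i" "br (h i) (e j) = sc (of_int (A i j)) (e j)"
      using rel i(1) j(1) by (simp_all add: chevalley_relations_def)
    hence "sc (of_int (A i j)) (e j) = 0"
      by (simp add: i(2) flip: \<open>br (e i) (f i) = h i\<close>)
    hence "A i j = 0" using j(2) by simp
    moreover have "A i j = 0 \<longrightarrow> A j i = 0"
      using gcm i(1) j(1) by (simp add: gen_cartan_matrix_def)
    ultimately show ?thesis by simp
  qed
  have proper: "J \<subset> {0..l}"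
  proof
    show "J \<subseteq> {0..l}" by (auto simp: J_def)
    show "J \<noteq> {0..l}" using e0 by (auto simp: J_def set_eq_iff)
  qed
  have "J = {}"
  proof (rule ccontr)
    assume "J \<noteq> {}"
    hence "\<exists>J. J \<noteq> {} \<and> J \<subset> {0..l} \<and> (\<forall>i \<in> J. \<forall>j \<in> {0..l} - J. A i j = 0 \<and> A j i = 0)"
      using proper split by (intro exI[of _ J] conjI ballI) simp_all
    thus False using indec unfolding indecomposable_def by (rule notE[rotated])
  qed
  hence e_zero: "e i = 0" if "i \<in> {1..l}" for i
    using that by (simp add: J_def)
  have "e ` {1..l} \<union> f ` {1..l} \<subseteq> {0}"
    by (auto simp: e_zero f)
  moreover have "subspace {0}" "\<forall>x \<in> {0}. \<forall>y \<in> {0}. br x y \<in> {0}"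
    by simp_all
  ultimately have "generated_subalgebra sc br (e ` {1..l} \<union> f ` {1..l}) \<subseteq> {0}"
    unfolding generated_subalgebra_def by (intro Inter_lower CollectI conjI)
  hence "br x y \<in> {0}" for x y
    unfolding gen by (rule subsetD) simp
  thus False using ncomm by simp
qed

text \<open>The affine node supplies the nonzero vectors \<open>e 0\<close> and \<open>f 0\<close> in degrees 1 and -1. The normalisation
  \<open>f 0 = - \<omega> (e 0)\<close> is exactly what makes \<open>\<Omega>\<close> act on them by \<open>\<omega>\<close>. That \<open>\<omega>\<close> is an involution
  holds on the generators of the simple algebra and hence everywhere.\<close>

lemma affine_involution_of_generators:
  assumes gcm: "gen_cartan_matrix l A" and indec: "indecomposable l A"
    and simple: "split_simple sc br l A e f h"
    and \<omega>: "classical_cartan_chevalley sc br l e f h \<omega>"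
    and ext: "extended_cartan_matrix sc br l A e f h \<omega>"
    and \<Omega>: "cartan_chevalley sc br B l e f h \<Omega>"
  shows "affine_involution sc br \<omega> B \<Omega>"
proof -
  have fds: "finite_dim_simple_lie_algebra sc br"
    and gen: "generated_subalgebra sc br (e ` {1..l} \<union> f ` {1..l}) = UNIV"
    using simple by (simp_all add: split_simple_def)
  interpret lie_type sc br
    using fds by (simp add: lie_type_def finite_dim_simple_lie_algebra_def)
  interpret finite_dim_lie_type sc br
    using fds by unfold_locales (simp add: finite_dim_simple_lie_algebra_def)
  have \<omega>_hom: "lie_hom \<omega> (lie_of sc br) (lie_of sc br)"
    and \<omega>_gen: "\<And>i. i \<in> {1..l} \<Longrightarrow> \<omega> (e i) = - f i" "\<And>i. i \<in> {1..l} \<Longrightarrow> \<omega> (f i) = - e i"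
    using \<omega> by (auto simp: classical_cartan_chevalley_def)
  have \<omega>_lin: "\<omega> (x + y) = \<omega> x + \<omega> y" "\<omega> (sc c x) = sc c (\<omega> x)" "\<omega> (br x y) = br (\<omega> x) (\<omega> y)" for x y c
    using \<omega>_hom by (simp_all add: lie_hom_def linear_between_def lie_of_def)
  have \<omega>_0: "\<omega> 0 = 0" using \<omega>_lin(1)[of 0 0] by simp
  have \<omega>_minus: "\<omega> (- x) = - \<omega> x" for x
    using \<omega>_lin(1)[of x "- x"] \<omega>_0 by (simp add: eq_neg_iff_add_eq_0 add.commute)
  have "generated_subalgebra sc br (e ` {1..l} \<union> f ` {1..l}) \<subseteq> {x. \<omega> (\<omega> x) = x}"
    unfolding generated_subalgebra_def
    by (intro Inter_lower) (auto simp: subspace_def \<omega>_0 \<omega>_lin \<omega>_gen \<omega>_minus)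
  hence invol: "\<omega> (\<omega> x) = x" for x
    using gen by blast
  have rel0: "chevalley_relations sc br {0..l} A e f h" and f0: "f 0 = - \<omega> (e 0)"
    using ext by (auto simp: extended_cartan_matrix_def)
  have f_zero: "f i = 0" if "i \<in> {1..l}" "e i = 0" for i
    using \<omega>_gen(1)[OF that(1)] that(2) \<omega>_0 by simp
  have ncomm: "\<exists>x y. br x y \<noteq> 0"
    using fds by (simp add: finite_dim_simple_lie_algebra_def)
  have e0: "e 0 \<noteq> 0"
    by (rule extended_generators_nonzero[OF lie_type_axioms ncomm gcm indec rel0 gen f_zero])
  have f0_nz: "f 0 \<noteq> 0"
    using e0 invol[of "e 0"] \<omega>_0 f0 by auto
  have \<Omega>_e: "\<Omega> (affine_e sc e i) = - affine_f sc f i" and \<Omega>_f: "\<Omega> (affine_f sc f i) = - affine_e sc e i"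
    if "i \<in> {0..l}" for i
    using \<Omega> that by (simp_all add: cartan_chevalley_def)
  have neg: "- in_affine (Poly_Mapping.single n x) = (in_affine (Poly_Mapping.single n (- x)) :: ('a, 'b) affine)" for n x
    by (simp add: in_affine_def single_uminus)
  show ?thesis
  proof
    show "\<exists>x y. br x y \<noteq> 0" by (rule ncomm)
    show "I = {0} \<or> I = UNIV" if "subspace I" "\<And>x y. y \<in> I \<Longrightarrow> br x y \<in> I" for I
      using fds that by (auto simp: finite_dim_simple_lie_algebra_def)
    show "lie_hom \<omega> (lie_of sc br) (lie_of sc br)" by (rule \<omega>_hom)
    show "\<omega> (\<omega> x) = x" for x by (rule invol)
    show "lie_hom \<Omega> (affine_algebra sc br B) (affine_algebra sc br B)"
      using \<Omega> by (simp add: cartan_chevalley_def)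
    show "\<Omega> (0, a, b) = (0, - a, - b)" for a b
    proof -
      have "(0, a, b) = (loop_tensor sc (tpow 0) 0, a, b)"
        by (simp add: loop_tensor_tpow)
      hence "(0, a, b) \<in> affine_cartan sc l h"
        using span_zero unfolding affine_cartan_def by blast
      thus ?thesis using \<Omega> by (simp add: cartan_chevalley_def)
    qed
    show "\<exists>X. generated_subalgebra sc br X = UNIV \<and>
        (\<forall>x \<in> X. \<Omega> (in_affine (Poly_Mapping.single 0 x)) = in_affine (Poly_Mapping.single 0 (\<omega> x)))"
    proof (intro exI conjI ballI)
      show "generated_subalgebra sc br (e ` {1..l} \<union> f ` {1..l}) = UNIV" by (rule gen)
      fix x assume "x \<in> e ` {1..l} \<union> f ` {1..l}"
      then obtain i where i: "i \<in> {1..l}" "x = e i \<or> x = f i" by blast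
      show "\<Omega> (in_affine (Poly_Mapping.single 0 x)) = in_affine (Poly_Mapping.single 0 (\<omega> x))"
        using i \<Omega>_e[of i] \<Omega>_f[of i] \<omega>_gen[OF i(1)]
        by (auto simp: affine_e_def affine_f_def loop_tensor_tpow neg)
    qed
    fix n :: int assume "n \<in> {1, - 1}"
    then consider "n = 1" | "n = - 1" by blast
    thus "\<exists>x. x \<noteq> 0 \<and> \<Omega> (in_affine (Poly_Mapping.single n x)) = in_affine (Poly_Mapping.single (- n) (\<omega> x))"
    proof cases
      case 1
      thus ?thesis
        using e0 \<Omega>_e[of 0] f0 by (intro exI[of _ "e 0"]) (simp add: affine_e_def affine_f_def loop_tensor_tpow neg)
    next
      case 2
      have "\<omega> (f 0) = - e 0" by (simp add: f0 \<omega>_minus invol)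
      thus ?thesis
        using f0_nz \<Omega>_f[of 0] 2 by (intro exI[of _ "f 0"]) (simp add: affine_e_def affine_f_def loop_tensor_tpow neg)
    qed
  qed
qed

theorem theoremA:
  fixes A :: "nat \<Rightarrow> nat \<Rightarrow> int" and l :: nat
    and sc :: "'k::real_or_complex \<Rightarrow> 'g::ab_group_add \<Rightarrow> 'g"
    and br :: "'g \<Rightarrow> 'g \<Rightarrow> 'g"
    and e f h :: "nat \<Rightarrow> 'g"
    and \<omega> :: "'g \<Rightarrow> 'g"
    and B :: "'g \<Rightarrow> 'g \<Rightarrow> 'k"
    and \<Omega> :: "('k, 'g) affine \<Rightarrow> ('k, 'g) affine"
    and \<kk> :: "('k, ('k, 'g) affine) lie_struct"
    and s :: 'k
  assumes "gen_cartan_matrix l A" and "indecomposable l A" and "affine_type l A"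
    and "split_simple sc br l A e f h"
    and "classical_cartan_chevalley sc br l e f h \<omega>"
    and "extended_cartan_matrix sc br l A e f h \<omega>"
    and "invariant_form sc br B"
    and "cartan_chevalley sc br B l e f h \<Omega>"
    and "\<kk> = fixed_subalgebra (affine_algebra sc br B) \<Omega>"
    and "s \<in> {1, -1}"
  shows "\<exists>\<rho>. is_rho sc br \<omega> s \<kk> \<rho> \<and>
           (\<forall>\<rho>'. is_rho sc br \<omega> s \<kk> \<rho>' \<longrightarrow> (\<forall>z \<in> lcarrier \<kk>. \<rho>' z = \<rho> z)) \<and>
           lie_mono \<rho> \<kk> (N_series sc br \<omega>) \<and>
           \<rho> ` lcarrier \<kk> \<noteq> lcarrier (N_series sc br \<omega>) \<and>
           (\<forall>N :: nat.
              lie_hom (trunc_proj sc br N) (N_series sc br \<omega>) (N_trunc sc br \<omega> N) \<and>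
              lie_epi (trunc_proj sc br N \<circ> \<rho>) \<kk> (N_trunc sc br \<omega> N))"
proof -
  interpret affine_involution sc br \<omega> B \<Omega>
    using assms by (intro affine_involution_of_generators)
  have s: "s * s = 1" using assms(10) by auto
  show ?thesis
    unfolding assms(9)
  proof (intro exI[of _ "cayley_map s"] conjI allI impI ballI)
    show "is_rho sc br \<omega> s fixed (cayley_map s)" by (rule cayley_map_is_rho[OF s])
    show "\<rho>' z = cayley_map s z" if "is_rho sc br \<omega> s fixed \<rho>'" "z \<in> lcarrier fixed" for \<rho>' z
      using that by (rule is_rho_unique[OF s])
    show "lie_mono (cayley_map s) fixed (N_series sc br \<omega>)" by (rule cayley_map_mono[OF s])
    show "cayley_map s ` lcarrier fixed \<noteq> lcarrier (N_series sc br \<omega>)"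
      by (rule cayley_map_not_surjective[OF s])
    show "lie_hom (trunc_proj sc br N) (N_series sc br \<omega>) (N_trunc sc br \<omega> N)" for N
      by (rule trunc_proj_lie_hom)
    show "lie_epi (trunc_proj sc br N \<circ> cayley_map s) fixed (N_trunc sc br \<omega> N)" for N
      by (rule trunc_cayley_map_epi[OF s])
  qed
qed

end
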